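(* Let $G$ be a signed block graph of order $n$ with $k$ blocks $B_1,\dots,B_k$, where $B_i$ has $n_i$ vertices. Suppose all edges incident to cut-vertices of $G$ are positive, and for each $i$ the block $B_i$ contains $m_i$ vertex-disjoint negative cliques, each on $r_i$ vertices, with $0\le m_ir_i\le n_i-1$, all other edges of $B_i$ being positive. Then $$\det(G)=(-1)^{n-k}\sum\prod_{i=1}^k(1-2r_i)^{m_i-1}(-1)^{-m_ir_i}\Big(\alpha_i(1-2r_i)+2r_i\big(1+m_i(r_i-1)\big)-1\Big),$$ where the sum is over all $k$-tuples $(\alpha_1,\dots,\alpha_k)$ of nonnegative integers such that (1) $\sum_{i=1}^k\alpha_i=n$, and (2) for every nonempty $S\subseteq\{1,\dots,k\}$, $\sum_{i\in S}\alpha_i\le|V(G_S)|$, where $G_S$ is the subgraph of $G$ induced by the blocks $B_i$, $i\in S$.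
   Context: A signed graph is a simple undirected graph with edge weights in $\{1,-1\}$ (positive/negative edges); $\det(G)$ is the determinant of its adjacency matrix, whose $(i,j)$ entry is the weight of edge $\{i,j\}$ and $0$ otherwise. A block is a maximal connected subgraph without a cut-vertex; a signed block graph is one in which each block is a signed complete graph. A negative clique is an induced complete subgraph all of whose edges have weight $-1$. *)

theory Defs
  imports "HOL-Analysis.Determinants" "HOL-Library.FuncSet" "HOL-Library.Disjoint_Sets"
begin

type_synonym 'v graph = "'v set \<times> 'v set set"

abbreviation verts :: "'v graph \<Rightarrow> 'v set" where "verts G \<equiv> fst G"
abbreviation edges :: "'v graph \<Rightarrow> 'v set set" where "edges G \<equiv> snd G"

definition simple_graph :: "'v graph \<Rightarrow> bool" where
  "simple_graph G \<longleftrightarrow> finite (verts G) \<and> (\<forall>e\<in>edges G. e \<subseteq> verts G \<and> card e = 2)"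

definition signed_graph :: "'v graph \<Rightarrow> ('v set \<Rightarrow> real) \<Rightarrow> bool" where
  "signed_graph G w \<longleftrightarrow> simple_graph G \<and> (\<forall>e\<in>edges G. w e \<in> {1, -1})"

definition adjacency_matrix :: "('v::finite) graph \<Rightarrow> ('v set \<Rightarrow> real) \<Rightarrow> real^'v^'v" where
  "adjacency_matrix G w = (\<chi> i j. if {i, j} \<in> edges G then w {i, j} else 0)"

definition is_subgraph :: "'v graph \<Rightarrow> 'v graph \<Rightarrow> bool" where
  "is_subgraph H G \<longleftrightarrow> simple_graph H \<and> verts H \<subseteq> verts G \<and> edges H \<subseteq> edges G"

definition linked :: "'v graph \<Rightarrow> 'v \<Rightarrow> 'v \<Rightarrow> bool" where
  "linked G = (\<lambda>u v. {u, v} \<in> edges G)\<^sup>*\<^sup>*"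

definition connected_graph :: "'v graph \<Rightarrow> bool" where
  "connected_graph G \<longleftrightarrow> verts G \<noteq> {} \<and> (\<forall>u\<in>verts G. \<forall>v\<in>verts G. linked G u v)"

definition graph_components :: "'v graph \<Rightarrow> 'v set set" where
  "graph_components G = (\<lambda>u. {v \<in> verts G. linked G u v}) ` verts G"

definition delete_vertex :: "'v graph \<Rightarrow> 'v \<Rightarrow> 'v graph" where
  "delete_vertex G x = (verts G - {x}, {e \<in> edges G. x \<notin> e})"

definition cut_vertex :: "'v graph \<Rightarrow> 'v \<Rightarrow> bool" where
  "cut_vertex G x \<longleftrightarrow> x \<in> verts G \<and>
     card (graph_components (delete_vertex G x)) > card (graph_components G)"

text \<open>The cut-vertices excluded here are those of the subgraph itself, not of the ambient graph.\<close>

definition nonseparable :: "'v graph \<Rightarrow> bool" where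
  "nonseparable H \<longleftrightarrow> connected_graph H \<and> (\<forall>x. \<not> cut_vertex H x)"

definition is_block :: "'v graph \<Rightarrow> 'v graph \<Rightarrow> bool" where
  "is_block G H \<longleftrightarrow> is_subgraph H G \<and> nonseparable H \<and>
     (\<forall>H'. is_subgraph H' G \<and> nonseparable H' \<and> is_subgraph H H' \<longrightarrow> H' = H)"

definition complete_graph :: "'v graph \<Rightarrow> bool" where
  "complete_graph G \<longleftrightarrow> (\<forall>u\<in>verts G. \<forall>v\<in>verts G. u \<noteq> v \<longrightarrow> {u, v} \<in> edges G)"

definition signed_block_graph :: "'v graph \<Rightarrow> ('v set \<Rightarrow> real) \<Rightarrow> bool" where
  "signed_block_graph G w \<longleftrightarrow> signed_graph G w \<and> (\<forall>H. is_block G H \<longrightarrow> complete_graph H)"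

text \<open>A clique is represented by its vertex set.\<close>

definition negative_clique :: "'v graph \<Rightarrow> ('v set \<Rightarrow> real) \<Rightarrow> 'v set \<Rightarrow> bool" where
  "negative_clique G w C \<longleftrightarrow> C \<subseteq> verts G \<and>
     (\<forall>u\<in>C. \<forall>v\<in>C. u \<noteq> v \<longrightarrow> {u, v} \<in> edges G \<and> w {u, v} = -1)"

definition admissible_tuples :: "'v graph \<Rightarrow> nat \<Rightarrow> (nat \<Rightarrow> 'v graph) \<Rightarrow> (nat \<Rightarrow> nat) set" where
  "admissible_tuples G k B = {\<alpha> \<in> {1..k} \<rightarrow>\<^sub>E UNIV.
     (\<Sum>i=1..k. \<alpha> i) = card (verts G) \<and>
     (\<forall>S. S \<noteq> {} \<and> S \<subseteq> {1..k} \<longrightarrow> (\<Sum>i\<in>S. \<alpha> i) \<le> card (\<Union>i\<in>S. verts (B i)))}"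

end

theory Submission
  imports Defs "HOL-Library.Transitive_Closure_Table"
begin

text \<open>
  Blocks are linked in a tree-like fashion: two vertices of a block are not connected by edges
  outside that block. Hence a permutation that moves every vertex along an edge keeps each of its
  cycles inside one block, and the Leibniz formula turns the determinant into a sum, over all maps
  \<open>\<phi>\<close> sending each vertex to a block containing it, of determinants that are block diagonal along
  the fibres of \<open>\<phi>\<close>. Such a block diagonal matrix is \<open>I - 2 K + F\<close>, where \<open>F\<close> and \<open>K\<close> are the
  indicator matrices of two nested partitions: the fibres of \<open>\<phi>\<close>, and the negative cliques
  completed by singletons. Its determinant factors over the classes of both partitions. Finally
  \<open>\<phi>\<close> is determined by its fibre sizes \<open>\<alpha>\<close>, again because there are no cycles of blocks, and by
  Hall's theorem the tuples that occur are exactly the admissible ones.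
\<close>

section \<open>Determinants of low-rank updates\<close>

lemma det_identity_replace_row:
  fixes y :: "'a::field^'n::finite"
  assumes "finite S" "l \<notin> S"
  shows "det (\<chi> i. if i = l then y else if i \<in> S then axis i 1 + c i *s y else axis i 1) = y $ l"
  using assms
proof (induction S rule: finite_induct)
  case empty
  have row_mat_1: "row i (mat 1 :: 'a^'n^'n) = axis i 1" for i
    by (vector row_def mat_def axis_def)
  have "(\<Sum>i\<in>UNIV. y $ i *s row i (mat 1 :: 'a^'n^'n)) = y"
    by (simp add: row_mat_1 basis_expansion)
  then show ?case
    using cramer_lemma_transpose[of l y "mat 1 :: 'a^'n^'n"]
    by (simp add: row_mat_1 cong: if_cong)
next
  case (insert t S)
  let ?A = "\<chi> i. if i = l then y else if i \<in> S then axis i 1 + c i *s y else axis i 1"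
  have "(\<chi> i. if i = l then y else if i \<in> insert t S then axis i 1 + c i *s y else axis i 1)
     = (\<chi> i. if i = t then row t ?A + c t *s row l ?A else row i ?A)"
    using insert.hyps insert.prems by (auto simp: vec_eq_iff row_def)
  then show ?case
    using insert det_row_operation[of t l ?A "c t"] by fastforce
qed

lemma det_identity_plus_rank_one:
  fixes x y :: "'a::field^'n::finite"
  shows "det (\<chi> i. axis i 1 + x $ i *s y) = 1 + (\<Sum>i\<in>UNIV. x $ i * y $ i)"
proof -
  have "det (\<chi> i. if i \<in> S then axis i 1 + x $ i *s y else axis i 1) = 1 + (\<Sum>i\<in>S. x $ i * y $ i)"
    for S
    using finite[of S]
  proof (induction S rule: finite_induct)
    case empty
    have "(\<chi> i. axis i 1) = (mat 1 :: 'a^'n^'n)"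
      by (vector mat_def axis_def)
    then show ?case by simp
  next
    case (insert l S)
    let ?R = "\<lambda>i. if i \<in> S then axis i 1 + x $ i *s y else axis i 1"
    have "det (\<chi> i. if i \<in> insert l S then axis i 1 + x $ i *s y else axis i 1)
        = det (\<chi> i. if i = l then axis i 1 + x $ i *s y else ?R i)"
      by (rule arg_cong[where f = det]) (auto simp: vec_eq_iff)
    also have "\<dots> = det (\<chi> i. if i = l then axis i 1 else ?R i)
        + det (\<chi> i. if i = l then x $ i *s y else ?R i)"
      by (rule det_row_add)
    also have "(\<chi> i. if i = l then axis i 1 else ?R i) = (\<chi> i. ?R i)"
      using insert.hyps by (auto simp: vec_eq_iff)
    also have "det (\<chi> i. if i = l then x $ i *s y else ?R i)
        = x $ l * det (\<chi> i. if i = l then y else ?R i)"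
      using det_row_mul[of l "x $ l" "\<lambda>_. y" ?R] by (simp cong: if_cong)
    also have "det (\<chi> i. if i = l then y else ?R i) = y $ l"
      by (rule det_identity_replace_row) (use insert.hyps in auto)
    finally show ?case
      using insert by simp
  qed
  from this[of UNIV] show ?thesis by simp
qed

lemma det_plus_rank_one:
  fixes M :: "'a::field^'n::finite^'n"
  assumes "M *v x = u"
  shows "det (\<chi> i j. M $ i $ j + u $ i * y $ j) = det M * (1 + (\<Sum>i\<in>UNIV. x $ i * y $ i))"
proof -
  have "(\<chi> i j. M $ i $ j + u $ i * y $ j) = M ** (\<chi> i. axis i 1 + x $ i *s y)"
    unfolding assms[symmetric]
    by (simp add: vec_eq_iff matrix_matrix_mult_def matrix_vector_mult_def axis_def distrib_left
        sum.distrib sum_distrib_right mult.assoc if_distrib[where f = "\<lambda>z. _ * z"] cong: if_cong)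
  then show ?thesis
    by (simp add: det_mul det_identity_plus_rank_one)
qed

lemma det_plus_orthogonal_rank_ones:
  fixes M :: "'a::field^'n::finite^'n"
  assumes "finite I" "\<And>i. i \<in> I \<Longrightarrow> M *v x i = u i"
    and "\<And>i j. i \<in> I \<Longrightarrow> j \<in> I \<Longrightarrow> i \<noteq> j \<Longrightarrow> (\<Sum>v\<in>UNIV. x i $ v * y j $ v) = 0"
  shows "det (\<chi> a b. M $ a $ b + (\<Sum>i\<in>I. u i $ a * y i $ b))
       = det M * (\<Prod>i\<in>I. 1 + (\<Sum>v\<in>UNIV. x i $ v * y i $ v))"
  using assms
proof (induction I rule: finite_induct)
  case empty
  then show ?case by simp
next
  case (insert l I)
  let ?M = "\<chi> a b. M $ a $ b + (\<Sum>i\<in>I. u i $ a * y i $ b)"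
  have "(\<Sum>b\<in>UNIV. (\<Sum>i\<in>I. u i $ a * y i $ b) * x l $ b) = 0" for a
  proof -
    have "(\<Sum>b\<in>UNIV. (\<Sum>i\<in>I. u i $ a * y i $ b) * x l $ b)
        = (\<Sum>i\<in>I. u i $ a * (\<Sum>b\<in>UNIV. x l $ b * y i $ b))"
      unfolding sum_distrib_right sum_distrib_left by (subst sum.swap) (simp add: mult_ac)
    also have "\<dots> = 0"
      using insert by (intro sum.neutral) auto
    finally show ?thesis .
  qed
  then have "?M *v x l = M *v x l"
    by (simp add: vec_eq_iff matrix_vector_mult_def distrib_right sum.distrib)
  then have "?M *v x l = u l"
    using insert by simp
  from det_plus_rank_one[OF this, of "y l"] show ?case
    using insert by (simp add: add_ac mult_ac)
qed

lemma det_plus_same_fibre: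
  fixes M :: "'a::field^'n::finite^'n" and \<phi> :: "'n \<Rightarrow> 'i"
  assumes M: "\<And>i u. (\<Sum>v | \<phi> v = i. M $ u $ v * x v) = of_bool (\<phi> u = i)"
    and I: "finite I" "range \<phi> \<subseteq> I"
  shows "det (\<chi> u v. M $ u $ v + b * of_bool (\<phi> u = \<phi> v))
       = det M * (\<Prod>i\<in>I. 1 + b * (\<Sum>v | \<phi> v = i. x v))"
proof -
  let ?x = "\<lambda>i. \<chi> v. of_bool (\<phi> v = i) * x v"
  let ?u = "\<lambda>i. \<chi> v. of_bool (\<phi> v = i)"
  let ?y = "\<lambda>i. \<chi> v. b * of_bool (\<phi> v = i)"
  have "(\<Sum>i\<in>I. of_bool (\<phi> u = i) * (b * of_bool (\<phi> v = i))) = b * of_bool (\<phi> u = \<phi> v)" for u v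
    using I by (subst sum_of_bool_mult_eq) (auto simp: image_subset_iff)
  then have "det (\<chi> u v. M $ u $ v + b * of_bool (\<phi> u = \<phi> v))
      = det (\<chi> u v. M $ u $ v + (\<Sum>i\<in>I. ?u i $ u * ?y i $ v))"
    by simp
  also have "\<dots> = det M * (\<Prod>i\<in>I. 1 + (\<Sum>v\<in>UNIV. ?x i $ v * ?y i $ v))"
  proof (rule det_plus_orthogonal_rank_ones)
    show "M *v ?x i = ?u i" for i
    proof -
      have "(\<Sum>v\<in>UNIV. M $ u $ v * (of_bool (\<phi> v = i) * x v))
          = (\<Sum>v | \<phi> v = i. M $ u $ v * x v)" for u
        by (intro sum.mono_neutral_cong_right) auto
      then show ?thesis
        by (simp add: vec_eq_iff matrix_vector_mult_def M)
    qed
  qed (use I in \<open>auto intro!: sum.neutral\<close>)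
  also have "\<dots> = det M * (\<Prod>i\<in>I. 1 + b * (\<Sum>v | \<phi> v = i. x v))"
  proof -
    have "(\<Sum>v\<in>UNIV. ?x i $ v * ?y i $ v) = b * (\<Sum>v | \<phi> v = i. x v)" for i
      unfolding sum_distrib_left by (intro sum.mono_neutral_cong_right) auto
    then show ?thesis by simp
  qed
  finally show ?thesis .
qed

lemma det_identity_plus_nested_partitions:
  fixes \<kappa> :: "'v::finite \<Rightarrow> 'c" and \<phi> :: "'v \<Rightarrow> 'i" and a b :: "'a::field"
  assumes refines: "\<And>u v. \<kappa> u = \<kappa> v \<Longrightarrow> \<phi> u = \<phi> v"
    and nonzero: "\<And>v. 1 + a * of_nat (card {u. \<kappa> u = \<kappa> v}) \<noteq> 0"
    and I: "finite I" "range \<phi> \<subseteq> I"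
  shows "det (\<chi> u v. of_bool (u = v) + a * of_bool (\<kappa> u = \<kappa> v) + b * of_bool (\<phi> u = \<phi> v))
       = (\<Prod>c\<in>range \<kappa>. 1 + a * of_nat (card {u. \<kappa> u = c}))
         * (\<Prod>i\<in>I. 1 + b * (\<Sum>v | \<phi> v = i. 1 / (1 + a * of_nat (card {u. \<kappa> u = \<kappa> v}))))"
proof -
  let ?M = "\<chi> u v. of_bool (u = v) + a * of_bool (\<kappa> u = \<kappa> v)"
  let ?x = "\<lambda>v. 1 / (1 + a * of_nat (card {u. \<kappa> u = \<kappa> v}))"
  have "det (\<chi> u v. (mat 1 :: 'a^'v^'v) $ u $ v + a * of_bool (\<kappa> u = \<kappa> v))
      = det (mat 1 :: 'a^'v^'v) * (\<Prod>c\<in>range \<kappa>. 1 + a * (\<Sum>v | \<kappa> v = c. 1))"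
    by (rule det_plus_same_fibre)
      (auto simp: mat_def if_distrib[where f = "\<lambda>z. z * _"] cong: if_cong)
  then have det_M: "det ?M = (\<Prod>c\<in>range \<kappa>. 1 + a * of_nat (card {u. \<kappa> u = c}))"
    unfolding det_I by (simp add: mat_def of_bool_def)
  have "(\<Sum>v | \<phi> v = i. ?M $ u $ v * ?x v) = of_bool (\<phi> u = i)" for i u
  proof -
    have "(\<Sum>v | \<phi> v = i. ?M $ u $ v * ?x v)
        = (\<Sum>v | \<phi> v = i. of_bool (u = v) * ?x v) + (\<Sum>v | \<phi> v = i. a * of_bool (\<kappa> u = \<kappa> v) * ?x v)"
      by (simp only: vec_lambda_beta distrib_right sum.distrib)
    also have "(\<Sum>v | \<phi> v = i. of_bool (u = v) * ?x v) = (\<Sum>v\<in>{u}. of_bool (\<phi> u = i) * ?x v)"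
      by (intro sum.mono_neutral_cong) auto
    also have "(\<Sum>v | \<phi> v = i. a * of_bool (\<kappa> u = \<kappa> v) * ?x v)
        = (\<Sum>v\<in>{v. \<kappa> v = \<kappa> u}. of_bool (\<phi> u = i) * (a * ?x u))"
      by (intro sum.mono_neutral_cong) (auto dest: refines)
    also have "(\<Sum>v\<in>{u}. of_bool (\<phi> u = i) * ?x v) + \<dots> = of_bool (\<phi> u = i)"
      using nonzero[of u] by (simp add: add_divide_distrib[symmetric])
    finally show ?thesis .
  qed
  from det_plus_same_fibre[OF this I, of b] show ?thesis
    by (simp add: det_M)
qed

section \<open>Hall's marriage theorem\<close>

definition hall_condition :: "'i set \<Rightarrow> ('i \<Rightarrow> 'v set) \<Rightarrow> bool" where
  "hall_condition I A \<longleftrightarrow> (\<forall>J\<subseteq>I. card J \<le> card (\<Union>j\<in>J. A j))"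

lemma not_hall_condition_updE:
  assumes "finite I" "hall_condition I A" "\<not> hall_condition I (A(i := S))"
  obtains J where "J \<subseteq> I - {i}" "card ((\<Union>j\<in>J. A j) \<union> S) \<le> card J"
proof -
  obtain J where J: "J \<subseteq> I" "card (\<Union>j\<in>J. (A(i := S)) j) < card J"
    using assms(3) by (auto simp: hall_condition_def not_le)
  have "i \<in> J"
  proof (rule ccontr)
    assume "i \<notin> J"
    then have "(\<Union>j\<in>J. (A(i := S)) j) = (\<Union>j\<in>J. A j)"
      by auto
    then show False
      using J assms(2) by (simp add: hall_condition_def leD)
  qed
  then have "(\<Union>j\<in>J. (A(i := S)) j) = (\<Union>j\<in>J - {i}. A j) \<union> S"
    by (auto split: if_splits)
  moreover have "card J = Suc (card (J - {i}))"
    using \<open>i \<in> J\<close> finite_subset[OF J(1) \<open>finite I\<close>] by (intro card.remove) auto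
  ultimately show ?thesis
    using J by (intro that[of "J - {i}"]) auto
qed

text \<open>Rado's argument: submodularity of \<open>J \<mapsto> card (\<Union>j\<in>J. A j)\<close>.\<close>

lemma hall_condition_remove_element:
  assumes fin: "finite I" "\<And>i. i \<in> I \<Longrightarrow> finite (A i)"
    and hall: "hall_condition I A"
    and "i \<in> I" "x \<in> A i" "y \<in> A i" "x \<noteq> y"
  shows "hall_condition I (A(i := A i - {x})) \<or> hall_condition I (A(i := A i - {y}))"
proof (rule ccontr)
  assume "\<not> ?thesis"
  then have no_x: "\<not> hall_condition I (A(i := A i - {x}))"
    and no_y: "\<not> hall_condition I (A(i := A i - {y}))"
    by auto
  obtain J where J: "J \<subseteq> I - {i}" "card ((\<Union>j\<in>J. A j) \<union> (A i - {x})) \<le> card J" (is "card ?P \<le> _")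
    by (rule not_hall_condition_updE[OF fin(1) hall no_x])
  obtain K where K: "K \<subseteq> I - {i}" "card ((\<Union>j\<in>K. A j) \<union> (A i - {y})) \<le> card K" (is "card ?Q \<le> _")
    by (rule not_hall_condition_updE[OF fin(1) hall no_y])
  have fin_JK: "finite J" "finite K"
    using finite_subset[OF J(1)] finite_subset[OF K(1)] fin(1) by auto
  then have fin_PQ: "finite ?P" "finite ?Q"
    using J K fin \<open>i \<in> I\<close> by auto
  have "card J + card K + 1 = card (insert i (J \<union> K)) + card (J \<inter> K)"
    using card_Un_Int[OF fin_JK] fin_JK J K by (subst card_insert_disjoint) auto
  also have "\<dots> \<le> card (\<Union>j\<in>insert i (J \<union> K). A j) + card (\<Union>j\<in>J \<inter> K. A j)"
    using J(1) K(1) \<open>i \<in> I\<close> by (intro add_mono hall[unfolded hall_condition_def, rule_format]) auto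
  also have "(\<Union>j\<in>insert i (J \<union> K). A j) = ?P \<union> ?Q"
    using assms(4-7) by auto
  also have "card (\<Union>j\<in>J \<inter> K. A j) \<le> card (?P \<inter> ?Q)"
    using fin_PQ by (intro card_mono) auto
  also have "card (?P \<union> ?Q) + card (?P \<inter> ?Q) = card ?P + card ?Q"
    using card_Un_Int[OF fin_PQ] by simp
  also have "\<dots> \<le> card J + card K"
    using J K by simp
  finally show False by simp
qed

lemma hall_marriage_subsingletons:
  assumes hall: "hall_condition I A"
    and subsingleton: "\<And>i x y. \<lbrakk>i \<in> I; x \<in> A i; y \<in> A i\<rbrakk> \<Longrightarrow> x = y"
  shows "\<exists>f. inj_on f I \<and> (\<forall>i\<in>I. f i \<in> A i)"
proof -
  note hall_card = hall[unfolded hall_condition_def, rule_format]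
  have "A i \<noteq> {}" if "i \<in> I" for i
    using hall_card[of "{i}"] that by auto
  then have "\<forall>i\<in>I. \<exists>x. x \<in> A i"
    by blast
  then obtain f where f: "\<And>i. i \<in> I \<Longrightarrow> f i \<in> A i"
    by metis
  have singleton: "A i = {f i}" if "i \<in> I" for i
    using f[OF that] subsingleton[OF that] by blast
  have "inj_on f I"
  proof (rule inj_onI)
    fix i j assume "i \<in> I" "j \<in> I" "f i = f j"
    then show "i = j"
      using hall_card[of "{i, j}"] singleton by (cases "i = j") auto
  qed
  then show ?thesis
    using f by (intro exI[of _ f]) simp
qed

theorem hall_marriage:
  assumes "finite I" "\<And>i. i \<in> I \<Longrightarrow> finite (A i)" "hall_condition I A"
  obtains f where "inj_on f I" "\<And>i. i \<in> I \<Longrightarrow> f i \<in> A i"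
proof -
  have "\<exists>f. inj_on f I \<and> (\<forall>i\<in>I. f i \<in> A i)"
    using assms
  proof (induction "\<Sum>i\<in>I. card (A i)" arbitrary: A rule: less_induct)
    case less
    show ?case
    proof (cases "\<exists>i\<in>I. \<exists>x\<in>A i. \<exists>y\<in>A i. x \<noteq> y")
      case True
      then obtain i z where "i \<in> I" "z \<in> A i" and removable: "hall_condition I (A(i := A i - {z}))"
        using hall_condition_remove_element[OF less.prems] by metis
      let ?A = "A(i := A i - {z})"
      have "card (?A i) < card (A i)"
        using less.prems(2) \<open>i \<in> I\<close> \<open>z \<in> A i\<close> by (simp only: fun_upd_same card_Diff1_less)
      then have smaller: "(\<Sum>j\<in>I. card (?A j)) < (\<Sum>j\<in>I. card (A j))"
        using less.prems(1) \<open>i \<in> I\<close> by (intro sum_strict_mono_ex1) (auto simp: card_Diff1_le)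
      have "finite (?A j)" if "j \<in> I" for j
        using less.prems(2)[OF that] by (cases "j = i") auto
      then obtain f where "inj_on f I" and f: "\<forall>j\<in>I. f j \<in> ?A j"
        using less.hyps[OF smaller less.prems(1) _ removable] by blast
      moreover have "f j \<in> A j" if "j \<in> I" for j
        using bspec[OF f that] by (cases "j = i") auto
      ultimately show ?thesis by blast
    next
      case False
      then show ?thesis
        by (intro hall_marriage_subsingletons[OF less.prems(3)]) blast
    qed
  qed
  with that show thesis by blast
qed

lemma hall_condition_copies:
  assumes "finite I"
    and bound: "\<And>S. S \<noteq> {} \<Longrightarrow> S \<subseteq> I \<Longrightarrow> sum \<alpha> S \<le> card (\<Union>i\<in>S. A i)"
  shows "hall_condition (SIGMA i:I. {..<\<alpha> i}) (\<lambda>p. A (fst p))"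
  unfolding hall_condition_def
proof (intro allI impI)
  fix J assume J: "J \<subseteq> (SIGMA i:I. {..<\<alpha> i})"
  show "card J \<le> card (\<Union>p\<in>J. A (fst p))"
  proof (cases "J = {}")
    case False
    have sub: "fst ` J \<subseteq> I" using J by auto
    then have "finite (fst ` J)" using \<open>finite I\<close> finite_subset by blast
    moreover have "J \<subseteq> (SIGMA i:fst ` J. {..<\<alpha> i})" using J by force
    ultimately have "card J \<le> card (SIGMA i:fst ` J. {..<\<alpha> i})"
      by (intro card_mono) auto
    also have "\<dots> = sum \<alpha> (fst ` J)"
      using \<open>finite (fst ` J)\<close> by simp
    also have "\<dots> \<le> card (\<Union>i\<in>fst ` J. A i)"
      using False sub by (intro bound) auto
    finally show ?thesis by simp
  qed simp
qed

corollary disjoint_subsets_of_prescribed_cards: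
  assumes fin: "finite I" "\<And>i. i \<in> I \<Longrightarrow> finite (A i)"
    and bound: "\<And>S. S \<noteq> {} \<Longrightarrow> S \<subseteq> I \<Longrightarrow> sum \<alpha> S \<le> card (\<Union>i\<in>S. A i)"
  obtains D where "disjoint_family_on D I" "\<And>i. i \<in> I \<Longrightarrow> D i \<subseteq> A i \<and> card (D i) = \<alpha> i"
proof -
  let ?T = "SIGMA i:I. {..<\<alpha> i}"
  obtain f where inj: "inj_on f ?T" and f: "\<And>p. p \<in> ?T \<Longrightarrow> f p \<in> A (fst p)"
    by (rule hall_marriage[OF _ _ hall_condition_copies[OF fin(1) bound]]) (use fin in auto)
  let ?D = "\<lambda>i. f ` ({i} \<times> {..<\<alpha> i})"
  show ?thesis
  proof (rule that)
    show "disjoint_family_on ?D I"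
      using inj by (auto simp: disjoint_family_on_def inj_on_def)
    show "?D i \<subseteq> A i \<and> card (?D i) = \<alpha> i" if "i \<in> I" for i
    proof
      show "?D i \<subseteq> A i"
        using f that by auto
      have "inj_on f ({i} \<times> {..<\<alpha> i})"
        by (rule inj_on_subset[OF inj]) (use that in auto)
      then show "card (?D i) = \<alpha> i"
        by (simp add: card_image)
    qed
  qed
qed

section \<open>Connectivity\<close>

lemma linked_refl [simp]: "linked G u u"
  by (simp add: linked_def)

lemma linked_edge: "{u, v} \<in> edges G \<Longrightarrow> linked G u v"
  by (auto simp: linked_def)

lemma linked_trans: "linked G u v \<Longrightarrow> linked G v x \<Longrightarrow> linked G u x"
  by (simp add: linked_def)

lemma linked_sym: "linked G u v \<Longrightarrow> linked G v u"
  unfolding linked_def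
  by (rule sympD[OF symp_rtranclp]) (auto intro: sympI simp: insert_commute)

lemma linked_mono: "linked G u v \<Longrightarrow> edges G \<subseteq> edges H \<Longrightarrow> linked H u v"
  unfolding linked_def by (rule rtranclp_mono[THEN predicate2D, rotated]) auto

lemma linked_delete_vertexD: "linked (delete_vertex G x) u v \<Longrightarrow> linked G u v"
  by (erule linked_mono) (auto simp: delete_vertex_def)

lemma linked_delete_vertex_mono:
  "linked (delete_vertex G x) u v \<Longrightarrow> edges G \<subseteq> edges H \<Longrightarrow> linked (delete_vertex H x) u v"
  by (erule linked_mono) (auto simp: delete_vertex_def)

lemma linked_distinct_walk:
  assumes "linked G a b"
  obtains f n where "f 0 = a" "f n = b" "inj_on f {..n}" "\<And>i. i < n \<Longrightarrow> {f i, f (Suc i)} \<in> edges G"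
proof -
  let ?R = "\<lambda>u v. {u, v} \<in> edges G"
  obtain xs where path: "rtrancl_path ?R a xs b" and "distinct (a # xs)"
    using assms unfolding linked_def rtranclp_eq_rtrancl_path by (metis rtrancl_path_distinct)
  show thesis
  proof
    let ?f = "\<lambda>i. (a # xs) ! i"
    show "?f 0 = a" by simp
    show "?f (length xs) = b"
      using path rtrancl_path_last[OF path]
      by (cases "xs = []") (auto elim: rtrancl_path.cases simp: last_conv_nth)
    show "{?f i, ?f (Suc i)} \<in> edges G" if "i < length xs" for i
      using rtrancl_path_nth[OF path that] by simp
    show "inj_on ?f {..length xs}"
      using \<open>distinct (a # xs)\<close> by (intro inj_on_nth) auto
  qed
qed

definition component :: "'v graph \<Rightarrow> 'v \<Rightarrow> 'v set" where
  "component G u = {v \<in> verts G. linked G u v}"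

lemma graph_components_eq_image: "graph_components G = component G ` verts G"
  by (simp add: graph_components_def component_def)

lemma component_eq_iff:
  assumes "u \<in> verts G" "v \<in> verts G"
  shows "component G u = component G v \<longleftrightarrow> linked G u v"
proof
  assume "component G u = component G v"
  moreover have "v \<in> component G v"
    using assms by (simp add: component_def)
  ultimately have "v \<in> component G u"
    by simp
  then show "linked G u v"
    by (simp add: component_def)
next
  assume "linked G u v"
  then have "linked G u x \<longleftrightarrow> linked G v x" for x
    by (meson linked_sym linked_trans)
  then show "component G u = component G v"
    by (simp add: component_def)
qed

lemma connected_graph_iff_card_components:
  assumes "finite (verts G)"
  shows "connected_graph G \<longleftrightarrow> card (graph_components G) = 1"
proof -
  have fin: "finite (graph_components G)"
    using assms by (simp add: graph_components_eq_image)
  then have "card (graph_components G) = 1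
      \<longleftrightarrow> graph_components G \<noteq> {} \<and> card (graph_components G) \<le> Suc 0"
    by (auto simp: le_Suc_eq)
  also have "\<dots> \<longleftrightarrow> connected_graph G"
    unfolding card_le_Suc0_iff_eq[OF fin]
    by (simp add: graph_components_eq_image connected_graph_def component_eq_iff)
  finally show ?thesis ..
qed

lemma UN_component_delete_vertex:
  assumes "u \<in> verts G - {v}"
  shows "(\<Union>x\<in>component (delete_vertex G v) u. component G x) = component G u"
proof -
  have "component G x = component G u" if "x \<in> component (delete_vertex G v) u" for x
  proof -
    have "x \<in> verts G" "linked G u x"
      using that linked_delete_vertexD[of G v u x]
      by (simp_all add: component_def delete_vertex_def)
    then show ?thesis
      using assms component_eq_iff[of u G x] by simp
  qed
  moreover have "u \<in> component (delete_vertex G v) u"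
    using assms by (simp add: component_def delete_vertex_def)
  ultimately show ?thesis
    by blast
qed

text \<open>Sending the component of \<open>u\<close> in \<open>G - v\<close> to the component of \<open>u\<close> in \<open>G\<close> is surjective, since
  \<open>v\<close> has a neighbour, and identifies the components of \<open>c\<close> and \<open>d\<close>.\<close>

lemma cut_vertexI:
  assumes G: "simple_graph G" and edges: "{v, c} \<in> edges G" "{v, d} \<in> edges G"
    and separated: "\<not> linked (delete_vertex G v) c d"
  shows "cut_vertex G v"
proof -
  let ?D = "delete_vertex G v"
  have ne: "v \<noteq> c" "v \<noteq> d" and in_G: "v \<in> verts G" "c \<in> verts G" "d \<in> verts G"
    using G edges by (fastforce simp: simple_graph_def)+
  have verts_D: "verts ?D = verts G - {v}"
    by (simp add: delete_vertex_def)
  define F where "F K = (\<Union>u\<in>K. component G u)" for K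
  have F: "F (component ?D u) = component G u" if "u \<in> verts G - {v}" for u
    unfolding F_def by (rule UN_component_delete_vertex[OF that])
  have v_c: "component G v = component G c" and v_d: "component G v = component G d"
    using in_G edges by (simp_all add: component_eq_iff linked_edge)
  have surj: "graph_components G \<subseteq> F ` graph_components ?D"
  proof
    fix K assume "K \<in> graph_components G"
    then obtain u where "u \<in> verts G - {v}" "K = component G u"
      using v_c in_G ne unfolding graph_components_eq_image by blast
    then show "K \<in> F ` graph_components ?D"
      unfolding graph_components_eq_image verts_D by (auto simp: F intro!: image_eqI)
  qed
  have fin: "finite (graph_components ?D)"
    using G by (simp add: graph_components_eq_image verts_D simple_graph_def)
  have "\<not> inj_on F (graph_components ?D)"
  proof
    assume "inj_on F (graph_components ?D)"
    moreover have "F (component ?D c) = F (component ?D d)"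
      using in_G ne v_c v_d by (simp add: F)
    ultimately have "component ?D c = component ?D d"
      using in_G ne by (auto simp: inj_on_def graph_components_eq_image verts_D)
    then show False
      using separated in_G ne by (simp add: component_eq_iff verts_D)
  qed
  then have "card (F ` graph_components ?D) < card (graph_components ?D)"
    using card_image_le[OF fin, of F] eq_card_imp_inj_on[OF fin, of F] by linarith
  moreover have "card (graph_components G) \<le> card (F ` graph_components ?D)"
    using fin surj by (intro card_mono) auto
  ultimately have "card (graph_components G) < card (graph_components ?D)"
    by simp
  then show ?thesis
    using in_G by (simp add: cut_vertex_def)
qed

lemma nonseparableI:
  assumes "connected_graph H" "finite (verts H)"
    and "\<And>x u v. \<lbrakk>u \<in> verts H - {x}; v \<in> verts H - {x}\<rbrakk> \<Longrightarrow> linked (delete_vertex H x) u v"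
  shows "nonseparable H"
proof -
  have "\<not> cut_vertex H x" for x
  proof (cases "verts H - {x} = {}")
    case True
    then have "graph_components (delete_vertex H x) = {}"
      by (simp only: graph_components_def delete_vertex_def fst_conv image_empty)
    then show ?thesis
      by (simp add: cut_vertex_def)
  next
    case False
    then have "connected_graph (delete_vertex H x)"
      using assms(3)[of _ x] by (simp add: connected_graph_def delete_vertex_def)
    then show ?thesis
      using assms(1,2) connected_graph_iff_card_components[of H]
        connected_graph_iff_card_components[of "delete_vertex H x"]
      by (simp add: cut_vertex_def delete_vertex_def)
  qed
  then show ?thesis
    using assms(1) by (simp add: nonseparable_def)
qed

lemma nonseparable_linked_delete_vertex:
  assumes "simple_graph H" "nonseparable H" "u \<in> verts H - {x}" "v \<in> verts H - {x}"
  shows "linked (delete_vertex H x) u v"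
proof (cases "x \<in> verts H")
  case True
  let ?D = "delete_vertex H x"
  have fin: "finite (verts H)" "finite (verts ?D)" and conn: "connected_graph H"
    using assms(1,2) by (simp_all add: simple_graph_def nonseparable_def delete_vertex_def)
  have in_D: "u \<in> verts ?D" "v \<in> verts ?D"
    using assms(3,4) by (simp_all add: delete_vertex_def)
  then have "card (graph_components ?D) \<noteq> 0"
    using fin(2) by (auto simp: graph_components_eq_image)
  moreover have "card (graph_components ?D) \<le> 1"
    using assms(2) True conn connected_graph_iff_card_components[OF fin(1)]
    by (auto simp: nonseparable_def cut_vertex_def not_less)
  ultimately have "connected_graph ?D"
    using connected_graph_iff_card_components[OF fin(2)] by simp
  then show ?thesis
    using in_D by (simp add: connected_graph_def)
next
  case False
  then have "edges (delete_vertex H x) = edges H"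
    using assms(1) by (auto simp: simple_graph_def delete_vertex_def)
  moreover have "linked H u v"
    using assms by (auto simp: nonseparable_def connected_graph_def)
  ultimately show ?thesis
    by (auto intro: linked_mono)
qed

lemma linked_through_subset:
  assumes "\<And>c d. c \<in> S \<Longrightarrow> d \<in> S \<Longrightarrow> linked G c d"
    and "\<exists>c\<in>S. linked G u c" "\<exists>d\<in>S. linked G v d"
  shows "linked G u v"
  using assms linked_sym linked_trans by metis

lemma nonseparable_extend:
  assumes H: "nonseparable H" and sub: "is_subgraph H H'" and fin: "finite (verts H')"
    and reach: "\<And>x u. \<lbrakk>u \<in> verts H' - verts H; x \<noteq> u\<rbrakk>
      \<Longrightarrow> \<exists>c \<in> verts H - {x}. linked (delete_vertex H' x) u c"
  shows "nonseparable H'"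
proof (rule nonseparableI[OF _ fin])
  have simple: "simple_graph H" and edges: "edges H \<subseteq> edges H'" and verts: "verts H \<subseteq> verts H'"
    using sub by (simp_all add: is_subgraph_def)
  have conn: "connected_graph H"
    using H by (simp add: nonseparable_def)
  show "linked (delete_vertex H' x) u v" if uv: "u \<in> verts H' - {x}" "v \<in> verts H' - {x}" for x u v
  proof (rule linked_through_subset[of "verts H - {x}"])
    show "linked (delete_vertex H' x) c d" if "c \<in> verts H - {x}" "d \<in> verts H - {x}" for c d
      using nonseparable_linked_delete_vertex[OF simple H that] edges
      by (rule linked_delete_vertex_mono)
    have "\<exists>c \<in> verts H - {x}. linked (delete_vertex H' x) y c" if "y \<in> verts H' - {x}" for y
    proof (cases "y \<in> verts H")
      case True
      then show ?thesis
        using that by (intro bexI[of _ y]) auto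
    qed (use that reach in auto)
    then show "\<exists>c \<in> verts H - {x}. linked (delete_vertex H' x) u c"
      "\<exists>d \<in> verts H - {x}. linked (delete_vertex H' x) v d"
      using uv by simp_all
  qed
  have to_H: "\<exists>c \<in> verts H. linked H' u c" if "u \<in> verts H'" for u
  proof (cases "u \<in> verts H")
    case False
    moreover obtain x where "x \<in> verts H"
      using conn by (auto simp: connected_graph_def)
    ultimately show ?thesis
      using reach[of u x] that linked_delete_vertexD by fastforce
  qed (auto intro: bexI[of _ u])
  have "linked H' c d" if "c \<in> verts H" "d \<in> verts H" for c d
    using conn that edges by (auto simp: connected_graph_def intro: linked_mono)
  then have "linked H' u v" if "u \<in> verts H'" "v \<in> verts H'" for u v
    by (rule linked_through_subset) (use that to_H in auto)
  then show "connected_graph H'"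
    using conn verts by (auto simp: connected_graph_def)
qed

definition graph_union :: "'v graph \<Rightarrow> 'v graph \<Rightarrow> 'v graph" where
  "graph_union H K = (verts H \<union> verts K, edges H \<union> edges K)"

lemma is_subgraph_graph_union:
  assumes "is_subgraph H G" "is_subgraph K G"
  shows "is_subgraph (graph_union H K) G"
    and "is_subgraph H (graph_union H K)" "is_subgraph K (graph_union H K)"
  using assms by (auto simp: is_subgraph_def graph_union_def simple_graph_def)

lemma nonseparable_graph_union:
  assumes H: "simple_graph H" "nonseparable H" and K: "simple_graph K" "nonseparable K"
    and ab: "a \<in> verts H \<inter> verts K" "b \<in> verts H \<inter> verts K" "a \<noteq> b"
  shows "nonseparable (graph_union H K)"
proof (rule nonseparable_extend[OF H(2)])
  show "is_subgraph H (graph_union H K)" "finite (verts (graph_union H K))"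
    using H(1) K(1) by (auto simp: is_subgraph_def graph_union_def simple_graph_def)
  fix x u assume u: "u \<in> verts (graph_union H K) - verts H" "x \<noteq> u"
  obtain c where c: "c \<in> {a, b}" "c \<noteq> x"
    using ab(3) by auto
  then have "linked (delete_vertex K x) u c"
    using ab u by (intro nonseparable_linked_delete_vertex[OF K]) (auto simp: graph_union_def)
  then have "linked (delete_vertex (graph_union H K) x) u c"
    by (rule linked_delete_vertex_mono) (simp add: graph_union_def)
  then show "\<exists>c \<in> verts H - {x}. linked (delete_vertex (graph_union H K) x) u c"
    using c ab by blast
qed

definition path_graph :: "(nat \<Rightarrow> 'v) \<Rightarrow> nat \<Rightarrow> 'v graph" where
  "path_graph f n = (f ` {..n}, (\<lambda>s. {f s, f (Suc s)}) ` {..<n})"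

lemma path_graph_linked_avoiding:
  assumes "s \<le> t" "t \<le> n" "x \<notin> f ` {s..t}"
  shows "linked (delete_vertex (path_graph f n) x) (f s) (f t)"
  using assms
proof (induction t rule: dec_induct)
  case base
  then show ?case by simp
next
  case (step t)
  then have "{f t, f (Suc t)} \<in> edges (delete_vertex (path_graph f n) x)"
    by (auto simp: delete_vertex_def path_graph_def)
  moreover have "linked (delete_vertex (path_graph f n) x) (f s) (f t)"
    using step by (auto simp: atLeastAtMostSuc_conv)
  ultimately show ?case
    using linked_trans linked_edge by metis
qed

lemma nonseparable_add_ear:
  assumes H: "simple_graph H" "nonseparable H"
    and f: "inj_on f {..n}" "f 0 \<in> verts H" "f n \<in> verts H"
  shows "nonseparable (graph_union H (path_graph f n))"
proof (rule nonseparable_extend[OF H(2)])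
  let ?P = "path_graph f n"
  let ?U = "graph_union H ?P"
  show "is_subgraph H ?U" "finite (verts ?U)"
    using H(1) by (auto simp: is_subgraph_def graph_union_def path_graph_def simple_graph_def)
  fix x u assume u: "u \<in> verts ?U - verts H" "x \<noteq> u"
  then obtain s where s: "s \<le> n" "u = f s"
    by (auto simp: graph_union_def path_graph_def)
  have "x \<notin> f ` {0..s} \<or> x \<notin> f ` {s..n}"
  proof (rule ccontr)
    assume "\<not> ?thesis"
    then obtain i j where "i \<le> s" "s \<le> j" "j \<le> n" "f i = x" "f j = x"
      by auto
    then have "i = j"
      using s(1) by (intro inj_onD[OF f(1)]) auto
    then show False
      using \<open>i \<le> s\<close> \<open>s \<le> j\<close> \<open>f i = x\<close> u(2) s(2) by simp
  qed
  then obtain c where c: "c \<in> verts H - {x}" "linked (delete_vertex ?P x) u c"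
  proof
    assume "x \<notin> f ` {0..s}"
    then show thesis
      using path_graph_linked_avoiding[of 0 s n x f] s f that[of "f 0"] linked_sym by fastforce
  next
    assume "x \<notin> f ` {s..n}"
    then show thesis
      using path_graph_linked_avoiding[of s n n x f] s f that[of "f n"] by fastforce
  qed
  moreover have "edges ?P \<subseteq> edges ?U"
    by (simp add: graph_union_def)
  ultimately show "\<exists>c \<in> verts H - {x}. linked (delete_vertex ?U x) u c"
    by (blast intro: linked_delete_vertex_mono)
qed

section \<open>Blocks\<close>

lemma is_block_imp_is_subgraph: "is_block G H \<Longrightarrow> is_subgraph H G"
  by (simp add: is_block_def)

lemma is_block_imp_simple_graph: "is_block G H \<Longrightarrow> simple_graph H"
  by (simp add: is_block_def is_subgraph_def)

lemma is_block_imp_nonseparable: "is_block G H \<Longrightarrow> nonseparable H"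
  by (simp add: is_block_def)

lemma is_block_maximal:
  "\<lbrakk>is_block G H; is_subgraph K G; nonseparable K; is_subgraph H K\<rbrakk> \<Longrightarrow> K = H"
  unfolding is_block_def by blast

lemma simple_graph_edgeD:
  "simple_graph G \<Longrightarrow> {u, v} \<in> edges G \<Longrightarrow> u \<in> verts G \<and> v \<in> verts G \<and> u \<noteq> v"
  by (auto simp: simple_graph_def dest!: bspec)

lemma nonseparable_subgraph_in_block:
  assumes G: "simple_graph G" and H: "is_subgraph H G" "nonseparable H"
  obtains K where "is_block G K" "is_subgraph H K"
proof -
  let ?P = "\<lambda>K. is_subgraph K G \<and> nonseparable K \<and> is_subgraph H K"
  let ?size = "\<lambda>K. card (verts K) + card (edges K)"
  have fin: "finite (verts G)" "finite (edges G)"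
    using G by (auto simp: simple_graph_def intro: finite_subset[of _ "Pow (verts G)"])
  have P_H: "?P H"
    using H by (auto simp: is_subgraph_def)
  have "?size K < Suc (?size G)" if "?P K" for K
    using that fin by (intro le_imp_less_Suc add_mono card_mono) (auto simp: is_subgraph_def)
  then obtain K where K: "?P K" and largest: "\<And>L. ?P L \<Longrightarrow> ?size L \<le> ?size K"
    using ex_has_greatest_nat[of ?P H ?size "Suc (?size G)"] P_H by blast
  have "L = K" if L: "is_subgraph L G" "nonseparable L" "is_subgraph K L" for L
  proof -
    have "verts K \<subseteq> verts L" "edges K \<subseteq> edges L" and "finite (verts L)" "finite (edges L)"
      using L fin by (auto simp: is_subgraph_def intro: finite_subset)
    moreover have "?size L \<le> ?size K"
      using L K by (intro largest) (auto simp: is_subgraph_def)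
    moreover have "card (verts K) \<le> card (verts L)" "card (edges K) \<le> card (edges L)"
      using calculation by (auto intro: card_mono)
    ultimately have "verts K = verts L" "edges K = edges L"
      by (simp_all add: card_seteq)
    then show ?thesis
      by (simp add: prod_eq_iff)
  qed
  then show thesis
    using K by (intro that[of K]) (auto simp: is_block_def)
qed

lemma edge_in_block:
  assumes G: "simple_graph G" and e: "{u, v} \<in> edges G"
  obtains H where "is_block G H" "{u, v} \<in> edges H"
proof -
  let ?H = "({u, v}, {{u, v}})"
  have "linked (delete_vertex ?H x) a b" if "a \<in> {u, v} - {x}" "b \<in> {u, v} - {x}" for a b x
    using that by (cases "a = b") (auto simp: delete_vertex_def insert_commute intro!: linked_edge)
  moreover have "linked ?H a b" if "a \<in> {u, v}" "b \<in> {u, v}" for a b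
    using that by (cases "a = b") (auto simp: insert_commute intro!: linked_edge)
  ultimately have "nonseparable ?H"
    by (intro nonseparableI) (simp_all add: connected_graph_def)
  moreover have "is_subgraph ?H G"
    using e G by (auto simp: is_subgraph_def simple_graph_def)
  ultimately obtain K where "is_block G K" "is_subgraph ?H K"
    using nonseparable_subgraph_in_block[OF G] by blast
  then show thesis
    using that by (simp add: is_subgraph_def)
qed

lemma blocks_eq_if_share_two_vertices:
  assumes H: "is_block G H" and K: "is_block G K"
    and ab: "a \<in> verts H \<inter> verts K" "b \<in> verts H \<inter> verts K" "a \<noteq> b"
  shows "H = K"
proof -
  note sub = is_subgraph_graph_union
    [OF is_block_imp_is_subgraph[OF H] is_block_imp_is_subgraph[OF K]]
  have "nonseparable (graph_union H K)"
    using H K ab by (intro nonseparable_graph_union)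
      (auto intro: is_block_imp_simple_graph is_block_imp_nonseparable)
  then show ?thesis
    using is_block_maximal[OF H sub(1) _ sub(2)] is_block_maximal[OF K sub(1) _ sub(3)] by simp
qed

lemma blocks_eq_if_share_edge:
  assumes H: "is_block G H" and K: "is_block G K" and e: "e \<in> edges H" "e \<in> edges K"
  shows "H = K"
proof -
  have "e \<subseteq> verts H" "e \<subseteq> verts K" "card e = 2"
    using e is_block_imp_simple_graph[OF H] is_block_imp_simple_graph[OF K]
    by (auto simp: simple_graph_def)
  moreover from this obtain a b where "e = {a, b}" "a \<noteq> b"
    by (auto simp: card_2_iff)
  ultimately show ?thesis
    by (intro blocks_eq_if_share_two_vertices[OF H K]) auto
qed

definition delete_edges :: "'v graph \<Rightarrow> 'v set set \<Rightarrow> 'v graph" where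
  "delete_edges G F = (verts G, edges G - F)"

lemma is_subgraph_path_graph:
  assumes G: "simple_graph G" and f: "f 0 \<in> verts G" "\<And>s. s < n \<Longrightarrow> {f s, f (Suc s)} \<in> edges G"
  shows "is_subgraph (path_graph f n) G"
proof -
  have "f s \<in> verts G" if "s \<le> n" for s
    using that f simple_graph_edgeD[OF G f(2)] by (cases s) auto
  then show ?thesis
    using f(2) G by (auto simp: is_subgraph_def path_graph_def simple_graph_def)
qed

text \<open>A path leaving a block through other edges and returning to it at another vertex would be an
  ear that could be added to the block.\<close>

lemma linked_outside_block_imp_eq:
  assumes G: "simple_graph G" and H: "is_block G H" and ab: "a \<in> verts H" "b \<in> verts H"
    and linked: "linked (delete_edges G (edges H)) a b"
  shows "a = b"
proof -
  obtain f n where f: "f 0 = a" "f n = b" "inj_on f {..n}"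
    and "\<And>s. s < n \<Longrightarrow> {f s, f (Suc s)} \<in> edges (delete_edges G (edges H))"
    using linked_distinct_walk[OF linked] by metis
  then have step: "{f s, f (Suc s)} \<in> edges G - edges H" if "s < n" for s
    using that by (simp add: delete_edges_def)
  have H_sub: "is_subgraph H G"
    by (rule is_block_imp_is_subgraph[OF H])
  then have "is_subgraph (path_graph f n) G"
    using step f ab by (intro is_subgraph_path_graph[OF G]) (auto simp: is_subgraph_def)
  note sub = is_subgraph_graph_union[OF H_sub this]
  have "nonseparable (graph_union H (path_graph f n))"
    using H f ab by (intro nonseparable_add_ear)
      (auto intro: is_block_imp_simple_graph is_block_imp_nonseparable)
  then have "graph_union H (path_graph f n) = H"
    by (rule is_block_maximal[OF H sub(1) _ sub(2)])
  then have "edges (path_graph f n) \<subseteq> edges H"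
    using sub(3) by (simp add: is_subgraph_def)
  then have "n = 0"
    using step[of 0] by (cases n) (auto simp: path_graph_def)
  then show ?thesis
    using f by simp
qed

lemma other_block_linked_outside:
  assumes H: "is_block G H" and K: "is_block G K" "H \<noteq> K" and uv: "u \<in> verts K" "v \<in> verts K"
  shows "linked (delete_edges G (edges H)) u v"
proof -
  have "linked K u v"
    using is_block_imp_nonseparable[OF K(1)] uv by (auto simp: nonseparable_def connected_graph_def)
  moreover have "edges K \<subseteq> edges (delete_edges G (edges H))"
    using is_block_imp_is_subgraph[OF K(1)] blocks_eq_if_share_edge[OF H K(1)] K(2)
    by (auto simp: delete_edges_def is_subgraph_def)
  ultimately show ?thesis
    by (rule linked_mono)
qed

lemma shared_vertex_has_neighbour_in_block:
  assumes H: "is_block G H" and K: "is_block G K" and "H \<noteq> K" and v: "v \<in> verts H" "v \<in> verts K"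
  obtains c where "{v, c} \<in> edges H"
proof -
  have simple: "simple_graph H"
    by (rule is_block_imp_simple_graph[OF H])
  have "verts H \<noteq> {v}"
  proof
    assume "verts H = {v}"
    then have "e \<subseteq> {v} \<and> card e = 2" if "e \<in> edges H" for e
      using simple that by (simp add: simple_graph_def)
    then have "edges H = {}"
      using subset_singletonD by fastforce
    then have "is_subgraph H K"
      using simple \<open>verts H = {v}\<close> v by (simp add: is_subgraph_def)
    then show False
      using is_block_maximal[OF H is_block_imp_is_subgraph[OF K] is_block_imp_nonseparable[OF K]]
        \<open>H \<noteq> K\<close> by simp
  qed
  then obtain y where "y \<in> verts H" "y \<noteq> v"
    using v by blast
  then have "linked H v y"
    using is_block_imp_nonseparable[OF H] v by (simp add: nonseparable_def connected_graph_def)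
  then show thesis
    using \<open>y \<noteq> v\<close> that unfolding linked_def by (auto elim: converse_rtranclpE)
qed

lemma linked_outside_until_hit:
  assumes H: "simple_graph H" and "linked (delete_vertex G v) d c" "c \<in> verts H - {v}"
  shows "\<exists>z \<in> verts H - {v}. linked (delete_edges G (edges H)) d z"
  using assms(2) unfolding linked_def[of "delete_vertex G v"]
proof (induction rule: converse_rtranclp_induct)
  case base
  show ?case
    using assms(3) by (intro bexI[of _ c]) auto
next
  case (step x y)
  show ?case
  proof (cases "x \<in> verts H")
    case True
    then show ?thesis
      using step(1) by (intro bexI[of _ x]) (auto simp: delete_vertex_def)
  next
    case False
    then have "{x, y} \<in> edges (delete_edges G (edges H))"
      using step(1) simple_graph_edgeD[OF H] by (auto simp: delete_vertex_def delete_edges_def)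
    then show ?thesis
      using step.IH linked_edge linked_trans by metis
  qed
qed

lemma vertex_in_two_blocks_is_cut_vertex:
  assumes G: "simple_graph G" and H: "is_block G H" and K: "is_block G K" and "H \<noteq> K"
    and v: "v \<in> verts H" "v \<in> verts K"
  shows "cut_vertex G v"
proof -
  obtain c d where edges: "{v, c} \<in> edges H" "{v, d} \<in> edges K"
    using shared_vertex_has_neighbour_in_block assms by metis
  have c: "c \<in> verts H - {v}" and d: "d \<in> verts K"
    using simple_graph_edgeD[OF is_block_imp_simple_graph[OF H] edges(1)]
      simple_graph_edgeD[OF is_block_imp_simple_graph[OF K] edges(2)] by auto
  show ?thesis
  proof (rule cut_vertexI[OF G])
    show "{v, c} \<in> edges G" "{v, d} \<in> edges G"
      using edges is_block_imp_is_subgraph[OF H] is_block_imp_is_subgraph[OF K]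
      by (auto simp: is_subgraph_def)
    show "\<not> linked (delete_vertex G v) c d"
    proof
      assume "linked (delete_vertex G v) c d"
      then obtain z where "z \<in> verts H - {v}" "linked (delete_edges G (edges H)) d z"
        using linked_outside_until_hit[OF is_block_imp_simple_graph[OF H] _ c] linked_sym by metis
      moreover have "linked (delete_edges G (edges H)) v d"
        by (rule other_block_linked_outside[OF H K \<open>H \<noteq> K\<close> v(2) d])
      ultimately show False
        using linked_outside_block_imp_eq[OF G H v(1), of z] linked_trans by fastforce
    qed
  qed
qed

lemma returning_walk_stays_in_block:
  fixes x :: "nat \<Rightarrow> 'v" and b :: "'v \<Rightarrow> 'v graph"
  assumes G: "simple_graph G" and b: "\<And>s. is_block G (b (x s))"
    and x: "\<And>s. x s \<in> verts (b (x s))" "\<And>s. x (Suc s) \<in> verts (b (x s))"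
    and return: "b (x p) = b (x 0)" "0 < p"
  shows "b (x 1) = b (x 0)"
proof -
  let ?H = "b (x 0)"
  let ?Q = "\<lambda>t. 1 \<le> t \<and> b (x t) = ?H"
  obtain t where t: "?Q t" and least: "\<And>s. s < t \<Longrightarrow> \<not> ?Q s"
    using exists_least_iff[of ?Q] return by (metis One_nat_def Suc_leI)
  have "linked (delete_edges G (edges ?H)) (x 1) (x s)" if "1 \<le> s" "s \<le> t" for s
    using that
  proof (induction s rule: dec_induct)
    case base
    then show ?case by simp
  next
    case (step s)
    then have "?H \<noteq> b (x s)"
      using least[of s] by auto
    then have "linked (delete_edges G (edges ?H)) (x s) (x (Suc s))"
      using b x by (intro other_block_linked_outside) auto
    then show ?case
      using step linked_trans by fastforce
  qed
  then have "x 1 = x t"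
    using t x(1)[of t] x(2)[of 0] by (intro linked_outside_block_imp_eq[OF G b]) auto
  then show ?thesis
    using t by simp
qed

section \<open>Assignments of vertices to blocks\<close>

definition block_assignments :: "'v graph \<Rightarrow> ('v \<Rightarrow> 'v graph) set" where
  "block_assignments G = {\<phi>. \<forall>v. is_block G (\<phi> v) \<and> v \<in> verts (\<phi> v)}"

lemma block_assignmentsD:
  assumes "\<phi> \<in> block_assignments G"
  shows "is_block G (\<phi> v)" "v \<in> verts (\<phi> v)"
  using assms by (simp_all add: block_assignments_def)

lemma block_assignment_invariant_under_permutation:
  fixes G :: "('v::finite) graph"
  assumes G: "simple_graph G" and p: "p permutes UNIV" and edge: "\<And>v. {v, p v} \<in> edges G"
  shows "\<exists>!\<phi>. \<phi> \<in> block_assignments G \<and> (\<forall>v. \<phi> (p v) = \<phi> v)"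
proof -
  have "\<exists>H. is_block G H \<and> {v, p v} \<in> edges H" for v
    using edge_in_block[OF G edge] by metis
  then obtain b where b: "\<And>v. is_block G (b v)" and "\<And>v. {v, p v} \<in> edges (b v)"
    by metis
  then have in_b: "v \<in> verts (b v)" "p v \<in> verts (b v)" "v \<noteq> p v" for v
    using simple_graph_edgeD[OF is_block_imp_simple_graph] by metis+
  have b_invariant: "b (p v) = b v" for v
  proof -
    obtain n where "n > 0" "(p ^^ n) v = v"
      using funpow_inj_finite[OF permutes_inj[OF p], of v] by auto
    then show ?thesis
      using returning_walk_stays_in_block[OF G, of b "\<lambda>s. (p ^^ s) v" n] b in_b by simp
  qed
  show ?thesis
  proof
    show "b \<in> block_assignments G \<and> (\<forall>v. b (p v) = b v)"
      using b in_b b_invariant by (simp add: block_assignments_def)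
    fix \<phi> assume \<phi>: "\<phi> \<in> block_assignments G \<and> (\<forall>v. \<phi> (p v) = \<phi> v)"
    show "\<phi> = b"
    proof
      fix v
      have "v \<in> verts (\<phi> v)" "p v \<in> verts (\<phi> v)" "is_block G (\<phi> v)"
        using \<phi> block_assignmentsD[of \<phi> G v] block_assignmentsD(2)[of \<phi> G "p v"] by auto
      then show "\<phi> v = b v"
        using blocks_eq_if_share_two_vertices[of G "\<phi> v" "b v" v "p v"] b in_b by auto
    qed
  qed
qed

lemma prod_permutation_eq_sum_block_assignments:
  fixes M :: "'a::comm_ring_1^'v::finite^'v"
  assumes G: "simple_graph G" and M: "\<And>u v. {u, v} \<notin> edges G \<Longrightarrow> M $ u $ v = 0"
    and p: "p permutes UNIV"
  shows "(\<Prod>v\<in>UNIV. M $ v $ p v)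
       = (\<Sum>\<phi>\<in>block_assignments G. \<Prod>v\<in>UNIV. if \<phi> v = \<phi> (p v) then M $ v $ p v else 0)"
    (is "?P = (\<Sum>\<phi>\<in>_. ?Q \<phi>)")
proof (cases "\<exists>v. M $ v $ p v = 0")
  case True
  then have "?P = 0" "?Q \<phi> = 0" for \<phi>
    by (auto intro!: prod_zero)
  then show ?thesis by simp
next
  case False
  then have "{v, p v} \<in> edges G" for v
    using M by blast
  from block_assignment_invariant_under_permutation[OF G p this]
  obtain b where b: "b \<in> block_assignments G" "\<forall>v. b (p v) = b v"
    and unique: "\<And>\<phi>. \<phi> \<in> block_assignments G \<Longrightarrow> \<forall>v. \<phi> (p v) = \<phi> v \<Longrightarrow> \<phi> = b"
    by metis
  have "?Q \<phi> = (if \<phi> = b then ?P else 0)" if \<phi>: "\<phi> \<in> block_assignments G" for \<phi>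
  proof (cases "\<phi> = b")
    case False
    then obtain v where "\<phi> v \<noteq> \<phi> (p v)"
      using unique[OF \<phi>] by metis
    then have "?Q \<phi> = 0"
      by (intro prod_zero) auto
    with False show ?thesis by simp
  qed (use b in simp)
  then show ?thesis
    using b by simp
qed

theorem det_eq_sum_block_assignments:
  fixes M :: "'a::comm_ring_1^'v::finite^'v"
  assumes G: "simple_graph G" and M: "\<And>u v. {u, v} \<notin> edges G \<Longrightarrow> M $ u $ v = 0"
  shows "det M = (\<Sum>\<phi>\<in>block_assignments G. det (\<chi> u v. if \<phi> u = \<phi> v then M $ u $ v else 0))"
proof -
  have "det M = (\<Sum>p | p permutes UNIV. of_int (sign p) *
      (\<Sum>\<phi>\<in>block_assignments G. \<Prod>v\<in>UNIV. if \<phi> v = \<phi> (p v) then M $ v $ p v else 0))"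
    unfolding det_def
    by (intro sum.cong) (simp_all add: prod_permutation_eq_sum_block_assignments[OF G M])
  also have "\<dots> = (\<Sum>\<phi>\<in>block_assignments G. det (\<chi> u v. if \<phi> u = \<phi> v then M $ u $ v else 0))"
    unfolding det_def sum_distrib_left by (subst sum.swap) simp
  finally show ?thesis .
qed

lemma fibre_not_subset_if_card_eq:
  fixes \<phi> \<psi> :: "'v::finite \<Rightarrow> 'b"
  assumes "card {u. \<phi> u = \<psi> v} = card {u. \<psi> u = \<psi> v}" "\<phi> v \<noteq> \<psi> v"
  shows "\<exists>u. \<phi> u = \<psi> v \<and> \<psi> u \<noteq> \<psi> v"
proof (rule ccontr)
  assume "\<not> ?thesis"
  then have "{u. \<phi> u = \<psi> v} \<subseteq> {u. \<psi> u = \<psi> v}" by blast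
  then have "{u. \<phi> u = \<psi> v} = {u. \<psi> u = \<psi> v}"
    using assms(1) by (intro card_subset_eq) auto
  with assms(2) show False by blast
qed

text \<open>If two assignments differ at a vertex, equality of the fibre sizes yields a closed walk
  through vertices at which they differ.\<close>

lemma block_assignment_eq_if_fibre_cards_eq:
  fixes G :: "('v::finite) graph"
  assumes G: "simple_graph G" and \<phi>: "\<phi> \<in> block_assignments G" and \<psi>: "\<psi> \<in> block_assignments G"
    and card_eq: "\<And>H. is_block G H \<Longrightarrow> card {v. \<phi> v = H} = card {v. \<psi> v = H}"
  shows "\<phi> = \<psi>"
proof (rule ccontr)
  assume "\<phi> \<noteq> \<psi>"
  then obtain v\<^sub>0 where v\<^sub>0: "\<phi> v\<^sub>0 \<noteq> \<psi> v\<^sub>0" by blast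
  have "\<exists>u. \<phi> u = \<psi> v \<and> \<psi> u \<noteq> \<psi> v" if "\<phi> v \<noteq> \<psi> v" for v
    using card_eq[OF block_assignmentsD(1)[OF \<psi>]] that by (rule fibre_not_subset_if_card_eq)
  then obtain f where f: "\<And>v. \<phi> v \<noteq> \<psi> v \<Longrightarrow> \<phi> (f v) = \<psi> v \<and> \<psi> (f v) \<noteq> \<psi> v"
    by metis
  define x where "x s = (f ^^ s) v\<^sub>0" for s
  have x_Suc: "x (Suc s) = f (x s)" for s
    by (simp add: x_def)
  have differ: "\<phi> (x s) \<noteq> \<psi> (x s)" for s
    by (induction s) (simp add: x_def v\<^sub>0, metis f x_Suc)
  have "\<not> inj x"
    using range_inj_infinite[of x] by auto
  then obtain s t where "s < t" "x s = x t"
    by (metis linorder_injI)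
  have "\<psi> (x (Suc s)) = \<psi> (x s)"
  proof -
    have "\<psi> (x (s + 1)) = \<psi> (x (s + 0))"
    proof (rule returning_walk_stays_in_block[OF G])
      show "\<psi> (x (s + (t - s))) = \<psi> (x (s + 0))" "0 < t - s"
        using \<open>s < t\<close> \<open>x s = x t\<close> by simp_all
      show "x (s + Suc l) \<in> verts (\<psi> (x (s + l)))" for l
        using f[OF differ[of "s + l"]] block_assignmentsD(2)[OF \<phi>, of "x (s + Suc l)"]
        by (simp add: x_Suc)
    qed (use block_assignmentsD[OF \<psi>] in simp_all)
    then show ?thesis by simp
  qed
  then show False
    using f[OF differ[of s]] by (simp add: x_Suc)
qed

lemma sum_card_fibres:
  fixes \<phi> :: "'v::finite \<Rightarrow> 'b"
  assumes "finite S" "inj_on B S"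
  shows "(\<Sum>i\<in>S. card {v. \<phi> v = B i}) = card {v. \<phi> v \<in> B ` S}"
proof -
  have "(\<Sum>i\<in>S. card {v. \<phi> v = B i}) = card (\<Union>i\<in>S. {v. \<phi> v = B i})"
    using assms by (intro card_UN_disjoint[symmetric]) (auto dest: inj_onD)
  also have "(\<Union>i\<in>S. {v. \<phi> v = B i}) = {v. \<phi> v \<in> B ` S}"
    by auto
  finally show ?thesis .
qed

lemma fibre_cards_mem_admissible_tuples:
  fixes G :: "('v::finite) graph"
  assumes "verts G = UNIV" and B: "bij_betw B {1..k} {H. is_block G H}"
    and \<phi>: "\<phi> \<in> block_assignments G"
  shows "(\<lambda>i\<in>{1..k}. card {v. \<phi> v = B i}) \<in> admissible_tuples G k B" (is "?\<alpha> \<in> _")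
proof -
  have sum_\<alpha>: "sum ?\<alpha> S = card {v. \<phi> v \<in> B ` S}" if "S \<subseteq> {1..k}" for S
  proof -
    have "sum ?\<alpha> S = (\<Sum>i\<in>S. card {v. \<phi> v = B i})"
      using that by (intro sum.cong) auto
    also have "\<dots> = card {v. \<phi> v \<in> B ` S}"
      using B that
      by (intro sum_card_fibres) (auto simp: bij_betw_def intro: finite_subset inj_on_subset)
    finally show ?thesis .
  qed
  have "{v. \<phi> v \<in> B ` {1..k}} = verts G"
    using assms(1) bij_betw_imp_surj_on[OF B] block_assignmentsD[OF \<phi>] by simp
  moreover have "sum ?\<alpha> S \<le> card (\<Union>i\<in>S. verts (B i))" if "S \<subseteq> {1..k}" for S
  proof -
    have "v \<in> (\<Union>i\<in>S. verts (B i))" if "\<phi> v \<in> B ` S" for v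
      using that block_assignmentsD(2)[OF \<phi>, of v] by auto
    then show ?thesis
      unfolding sum_\<alpha>[OF that] by (intro card_mono subsetI) simp_all
  qed
  ultimately show ?thesis
    using sum_\<alpha>[of "{1..k}"] by (auto simp: admissible_tuples_def)
qed

lemma admissible_tuple_imp_block_assignment:
  fixes G :: "('v::finite) graph"
  assumes verts: "verts G = UNIV" and B: "bij_betw B {1..k} {H. is_block G H}"
    and \<alpha>: "\<alpha> \<in> admissible_tuples G k B"
  obtains \<phi> where "\<phi> \<in> block_assignments G" "\<And>i. i \<in> {1..k} \<Longrightarrow> card {v. \<phi> v = B i} = \<alpha> i"
proof -
  obtain D where disj: "disjoint_family_on D {1..k}"
    and D: "\<And>i. i \<in> {1..k} \<Longrightarrow> D i \<subseteq> verts (B i) \<and> card (D i) = \<alpha> i"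
    by (rule disjoint_subsets_of_prescribed_cards[of "{1..k}" "\<lambda>i. verts (B i)" \<alpha>])
      (use \<alpha> in \<open>auto simp: admissible_tuples_def\<close>)
  have "card (\<Union>i\<in>{1..k}. D i) = (\<Sum>i\<in>{1..k}. card (D i))"
    using disj by (intro card_UN_disjoint) (auto simp: disjoint_family_on_def)
  also have "\<dots> = CARD('v)"
    using D \<alpha> verts by (simp add: admissible_tuples_def)
  finally have "(\<Union>i\<in>{1..k}. D i) = UNIV"
    by (intro card_subset_eq) auto
  then have "\<exists>i. i \<in> {1..k} \<and> v \<in> D i" for v
    by blast
  then obtain g where g: "\<And>v. g v \<in> {1..k} \<and> v \<in> D (g v)"
    by metis
  have g_unique: "g v = i" if "i \<in> {1..k}" "v \<in> D i" for i v
    using disjoint_family_onD[OF disj, of "g v" i] g[of v] that by blast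
  show thesis
  proof
    show "B \<circ> g \<in> block_assignments G"
      using g D bij_betwE[OF B] by (fastforce simp: block_assignments_def)
    show "card {v. (B \<circ> g) v = B i} = \<alpha> i" if i: "i \<in> {1..k}" for i
    proof -
      have "{v. (B \<circ> g) v = B i} = D i"
        using g i g_unique[OF i] inj_onD[OF bij_betw_imp_inj_on[OF B]] by fastforce
      then show ?thesis
        using D[OF i] by simp
    qed
  qed
qed

theorem bij_betw_block_assignments_admissible_tuples:
  fixes G :: "('v::finite) graph"
  assumes G: "simple_graph G" "verts G = UNIV" and B: "bij_betw B {1..k} {H. is_block G H}"
  shows "bij_betw (\<lambda>\<phi>. \<lambda>i\<in>{1..k}. card {v. \<phi> v = B i})
    (block_assignments G) (admissible_tuples G k B)" (is "bij_betw ?c _ _")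
proof (rule bij_betw_imageI)
  show "inj_on ?c (block_assignments G)"
  proof (rule inj_onI)
    fix \<phi> \<psi> assume \<phi>\<psi>: "\<phi> \<in> block_assignments G" "\<psi> \<in> block_assignments G" and eq: "?c \<phi> = ?c \<psi>"
    have "card {v. \<phi> v = H} = card {v. \<psi> v = H}" if "is_block G H" for H
    proof -
      have "H \<in> B ` {1..k}"
        using bij_betw_imp_surj_on[OF B] that by simp
      then obtain i where "i \<in> {1..k}" "H = B i"
        by blast
      then show ?thesis
        using fun_cong[OF eq, of i] by simp
    qed
    then show "\<phi> = \<psi>"
      by (rule block_assignment_eq_if_fibre_cards_eq[OF G(1) \<phi>\<psi>])
  qed
  show "?c ` block_assignments G = admissible_tuples G k B"
  proof (intro equalityI subsetI)
    fix \<alpha> assume "\<alpha> \<in> ?c ` block_assignments G"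
    then show "\<alpha> \<in> admissible_tuples G k B"
      using fibre_cards_mem_admissible_tuples[OF G(2) B] by blast
  next
    fix \<alpha> assume \<alpha>: "\<alpha> \<in> admissible_tuples G k B"
    obtain \<phi> where \<phi>: "\<phi> \<in> block_assignments G" "\<And>i. i \<in> {1..k} \<Longrightarrow> card {v. \<phi> v = B i} = \<alpha> i"
      using admissible_tuple_imp_block_assignment[OF G(2) B \<alpha>] by metis
    have "\<alpha> \<in> extensional {1..k}"
      using \<alpha> by (simp add: admissible_tuples_def PiE_def)
    then have "\<alpha> = ?c \<phi>"
      using \<phi>(2) by (intro extensionalityI[of _ "{1..k}"]) auto
    then show "\<alpha> \<in> ?c ` block_assignments G"
      using \<phi>(1) by blast
  qed
qed

section \<open>Signed block graphs with clustered negative edges\<close>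

lemma one_minus_double_neq_0: "1 - 2 * real s \<noteq> 0"
proof
  assume "1 - 2 * real s = 0"
  then have "real (2 * s) = real 1" by simp
  then have "2 * s = 1" by (simp only: of_nat_eq_iff)
  then show False by presburger
qed

text \<open>A vertex outside the negative cliques contributes \<open>-1\<close> to the sum over the fibre of its block;
  \<open>clique_correction s\<close> is what a vertex of a negative clique of size \<open>s\<close> contributes beyond that.\<close>

definition clique_correction :: "nat \<Rightarrow> real" where
  "clique_correction s = 1 + 1 / (1 - 2 * real s)"

lemma clique_correction_one [simp]: "clique_correction (Suc 0) = 0"
  by (simp add: clique_correction_def)

definition negative_class :: "'v graph \<Rightarrow> ('v set \<Rightarrow> real) \<Rightarrow> 'v \<Rightarrow> 'v set" where
  "negative_class G w v = insert v {u. {u, v} \<in> edges G \<and> w {u, v} = -1}"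

lemma signed_block_graph_imp_simple_graph: "signed_block_graph G w \<Longrightarrow> simple_graph G"
  by (simp add: signed_block_graph_def signed_graph_def)

locale cluster_signed_block_graph =
  fixes G :: "('v::finite) graph" and w :: "'v set \<Rightarrow> real"
  assumes signed_block: "signed_block_graph G w"
    and cut_vertex_positive: "\<lbrakk>cut_vertex G x; e \<in> edges G; x \<in> e\<rbrakk> \<Longrightarrow> w e = 1"
    and negative_trans: "\<lbrakk>{u, v} \<in> edges G; w {u, v} = -1; {v, x} \<in> edges G; w {v, x} = -1; u \<noteq> x\<rbrakk>
      \<Longrightarrow> {u, x} \<in> edges G \<and> w {u, x} = -1"
begin

abbreviation \<kappa> :: "'v \<Rightarrow> 'v set" where "\<kappa> \<equiv> negative_class G w"

lemmas simple = signed_block_graph_imp_simple_graph[OF signed_block]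

lemma block_edge:
  assumes "is_block G H" "u \<in> verts H" "v \<in> verts H" "u \<noteq> v"
  shows "{u, v} \<in> edges G"
proof -
  have "complete_graph H"
    using signed_block assms(1) unfolding signed_block_graph_def by blast
  then show ?thesis
    using assms is_block_imp_is_subgraph[OF assms(1)]
    by (auto simp: complete_graph_def is_subgraph_def)
qed

lemma negative_class_eq_iff: "\<kappa> u = \<kappa> v \<longleftrightarrow> u \<in> \<kappa> v"
proof
  assume "\<kappa> u = \<kappa> v"
  then show "u \<in> \<kappa> v"
    by (auto simp: negative_class_def)
next
  have sym: "y \<in> \<kappa> x" if "x \<in> \<kappa> y" for x y
    using that by (auto simp: negative_class_def insert_commute)
  have trans: "x \<in> \<kappa> z" if "x \<in> \<kappa> y" "y \<in> \<kappa> z" for x y z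
    using that negative_trans[of x y z] by (auto simp: negative_class_def)
  assume "u \<in> \<kappa> v"
  then show "\<kappa> u = \<kappa> v"
    using sym trans by blast
qed

lemma negative_class_fibre: "{u. \<kappa> u = \<kappa> v} = \<kappa> v"
  by (simp add: negative_class_eq_iff)

lemma negative_class_cut_vertex: "cut_vertex G v \<Longrightarrow> \<kappa> v = {v}"
  using cut_vertex_positive[of v] by (fastforce simp: negative_class_def)

lemma assignment_eq_block_if_not_cut_vertex:
  assumes "\<phi> \<in> block_assignments G" "is_block G H" "v \<in> verts H" "\<not> cut_vertex G v"
  shows "\<phi> v = H"
  using assms vertex_in_two_blocks_is_cut_vertex[OF simple] block_assignmentsD by metis

lemma assignment_eq_if_negative_class_eq:
  assumes \<phi>: "\<phi> \<in> block_assignments G" and "\<kappa> u = \<kappa> v"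
  shows "\<phi> u = \<phi> v"
proof (cases "u = v")
  case False
  then have edge: "{u, v} \<in> edges G" "w {u, v} = -1"
    using assms(2) unfolding negative_class_eq_iff by (simp_all add: negative_class_def)
  then have "\<not> cut_vertex G u" "\<not> cut_vertex G v"
    using cut_vertex_positive[OF _ edge(1)] by auto
  moreover obtain H where H: "is_block G H" "{u, v} \<in> edges H"
    using edge_in_block[OF simple edge(1)] by metis
  moreover have "u \<in> verts H" "v \<in> verts H"
    using simple_graph_edgeD[OF is_block_imp_simple_graph] H by metis+
  ultimately show ?thesis
    using assignment_eq_block_if_not_cut_vertex[OF \<phi>] by metis
qed simp

lemma adjacency_matrix_restricted:
  assumes \<phi>: "\<phi> \<in> block_assignments G"
  shows "(if \<phi> u = \<phi> v then adjacency_matrix G w $ u $ v else 0)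
       = of_bool (u = v) + (-2) * of_bool (\<kappa> u = \<kappa> v) + 1 * of_bool (\<phi> u = \<phi> v)"
proof -
  consider (diagonal) "u = v" | (separated) "\<phi> u \<noteq> \<phi> v" | (same_block) "u \<noteq> v" "\<phi> u = \<phi> v"
    by blast
  then show ?thesis
  proof cases
    case diagonal
    then show ?thesis
      using simple_graph_edgeD[OF simple, of u u] by (auto simp: adjacency_matrix_def)
  next
    case separated
    then have "\<kappa> u \<noteq> \<kappa> v" "u \<noteq> v"
      using assignment_eq_if_negative_class_eq[OF \<phi>, of u v] by auto
    with separated show ?thesis by simp
  next
    case same_block
    then have "{u, v} \<in> edges G"
      using block_assignmentsD[OF \<phi>, of u] block_assignmentsD(2)[OF \<phi>, of v]
      by (simp add: block_edge)
    moreover from this have "w {u, v} \<in> {1, -1}"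
      using signed_block by (simp add: signed_block_graph_def signed_graph_def)
    ultimately show ?thesis
      using same_block unfolding adjacency_matrix_def negative_class_eq_iff
      by (auto simp: negative_class_def)
  qed
qed

lemma sum_over_assignment_fibre:
  assumes \<phi>: "\<phi> \<in> block_assignments G" and H: "is_block G H"
  shows "(\<Sum>v | \<phi> v = H. 1 / (1 - 2 * real (card (\<kappa> v))))
       = (\<Sum>v\<in>verts H. clique_correction (card (\<kappa> v))) - real (card {v. \<phi> v = H})"
proof -
  have "(\<Sum>v | \<phi> v = H. clique_correction (card (\<kappa> v)))
      = (\<Sum>v\<in>verts H. clique_correction (card (\<kappa> v)))"
  proof (rule sum.mono_neutral_left)
    show "{v. \<phi> v = H} \<subseteq> verts H"
      using block_assignmentsD(2)[OF \<phi>] by blast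
    show "\<forall>v\<in>verts H - {v. \<phi> v = H}. clique_correction (card (\<kappa> v)) = 0"
      using assignment_eq_block_if_not_cut_vertex[OF \<phi> H] negative_class_cut_vertex by fastforce
  qed simp
  then show ?thesis
    by (simp add: clique_correction_def sum.distrib)
qed

lemma det_adjacency_matrix_restricted:
  assumes \<phi>: "\<phi> \<in> block_assignments G"
  shows "det (\<chi> u v. if \<phi> u = \<phi> v then adjacency_matrix G w $ u $ v else 0)
       = (\<Prod>c\<in>range \<kappa>. 1 - 2 * real (card c)) * (\<Prod>H | is_block G H.
           1 - real (card {v. \<phi> v = H}) + (\<Sum>v\<in>verts H. clique_correction (card (\<kappa> v))))"
proof -
  have "det (\<chi> u v. if \<phi> u = \<phi> v then adjacency_matrix G w $ u $ v else 0)
      = (\<Prod>c\<in>range \<kappa>. 1 + (-2) * real (card {u. \<kappa> u = c}))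
        * (\<Prod>H\<in>{H. is_block G H}.
            1 + 1 * (\<Sum>v | \<phi> v = H. 1 / (1 + (-2) * real (card {u. \<kappa> u = \<kappa> v}))))"
    unfolding adjacency_matrix_restricted[OF \<phi>]
  proof (rule det_identity_plus_nested_partitions)
    show "1 + (-2) * real (card {u. \<kappa> u = \<kappa> v}) \<noteq> 0" for v
      using one_minus_double_neq_0 by simp
    show "range \<phi> \<subseteq> {H. is_block G H}"
      using block_assignmentsD(1)[OF \<phi>] by blast
    show "\<phi> u = \<phi> v" if "\<kappa> u = \<kappa> v" for u v
      using that by (rule assignment_eq_if_negative_class_eq[OF \<phi>])
  qed simp
  also have "(\<Prod>c\<in>range \<kappa>. 1 + (-2) * real (card {u. \<kappa> u = c}))
      = (\<Prod>c\<in>range \<kappa>. 1 - 2 * real (card c))"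
    by (intro prod.cong) (auto simp: negative_class_fibre)
  also have "(\<Prod>H | is_block G H.
        1 + 1 * (\<Sum>v | \<phi> v = H. 1 / (1 + (-2) * real (card {u. \<kappa> u = \<kappa> v}))))
      = (\<Prod>H | is_block G H.
        1 - real (card {v. \<phi> v = H}) + (\<Sum>v\<in>verts H. clique_correction (card (\<kappa> v))))"
    by (intro prod.cong) (simp_all add: negative_class_fibre sum_over_assignment_fibre[OF \<phi>])
  finally show ?thesis .
qed

theorem det_adjacency_matrix_eq_sum_admissible_tuples:
  assumes verts: "verts G = UNIV" and B: "bij_betw B {1..k} {H. is_block G H}"
  shows "det (adjacency_matrix G w) = (\<Prod>c\<in>range \<kappa>. 1 - 2 * real (card c))
    * (\<Sum>\<alpha>\<in>admissible_tuples G k B. \<Prod>i=1..k.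
        1 - real (\<alpha> i) + (\<Sum>v\<in>verts (B i). clique_correction (card (\<kappa> v))))"
proof -
  let ?s = "\<lambda>H. \<Sum>v\<in>verts H. clique_correction (card (\<kappa> v))"
  let ?c = "\<lambda>\<phi>. \<lambda>i\<in>{1..k}. card {v. \<phi> v = B i}"
  have "det (adjacency_matrix G w)
      = (\<Sum>\<phi>\<in>block_assignments G.
          det (\<chi> u v. if \<phi> u = \<phi> v then adjacency_matrix G w $ u $ v else 0))"
    by (rule det_eq_sum_block_assignments[OF simple]) (simp add: adjacency_matrix_def)
  also have "\<dots> = (\<Prod>c\<in>range \<kappa>. 1 - 2 * real (card c))
      * (\<Sum>\<phi>\<in>block_assignments G. \<Prod>H | is_block G H. 1 - real (card {v. \<phi> v = H}) + ?s H)"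
    unfolding sum_distrib_left by (intro sum.cong refl det_adjacency_matrix_restricted)
  also have "(\<Sum>\<phi>\<in>block_assignments G. \<Prod>H | is_block G H. 1 - real (card {v. \<phi> v = H}) + ?s H)
      = (\<Sum>\<phi>\<in>block_assignments G. \<Prod>i=1..k. 1 - real (?c \<phi> i) + ?s (B i))"
    by (simp flip: prod.reindex_bij_betw[OF B])
  also have "\<dots> = (\<Sum>\<alpha>\<in>admissible_tuples G k B. \<Prod>i=1..k. 1 - real (\<alpha> i) + ?s (B i))"
    using bij_betw_block_assignments_admissible_tuples[OF simple verts B]
    by (rule sum.reindex_bij_betw)
  finally show ?thesis .
qed

end

locale block_graph_with_negative_cliques =
  fixes G :: "('v::finite) graph" and w :: "'v set \<Rightarrow> real"
    and k :: nat and B :: "nat \<Rightarrow> 'v graph" and m :: "nat \<Rightarrow> nat" and C :: "nat \<Rightarrow> nat \<Rightarrow> 'v set"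
  assumes signed_block: "signed_block_graph G w"
    and spanning: "verts G = UNIV"
    and blocks: "bij_betw B {1..k} {H. is_block G H}"
    and cut_vertex_positive: "\<lbrakk>cut_vertex G x; e \<in> edges G; x \<in> e\<rbrakk> \<Longrightarrow> w e = 1"
    and cliques: "\<lbrakk>i \<in> {1..k}; j \<in> {1..m i}\<rbrakk> \<Longrightarrow> negative_clique (B i) w (C i j)"
    and cliques_disjoint: "i \<in> {1..k} \<Longrightarrow> disjoint_family_on (C i) {1..m i}"
    and other_edges_positive:
      "\<lbrakk>i \<in> {1..k}; e \<in> edges (B i); \<not> (\<exists>j\<in>{1..m i}. e \<subseteq> C i j)\<rbrakk> \<Longrightarrow> w e = 1"
begin

lemma is_block_B: "i \<in> {1..k} \<Longrightarrow> is_block G (B i)"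
  using bij_betw_imp_surj_on[OF blocks] by blast

lemma clique_subset: "\<lbrakk>i \<in> {1..k}; j \<in> {1..m i}\<rbrakk> \<Longrightarrow> C i j \<subseteq> verts (B i)"
  using cliques by (simp add: negative_clique_def)

lemma clique_edge_negative:
  assumes "i \<in> {1..k}" "j \<in> {1..m i}" "u \<in> C i j" "v \<in> C i j" "u \<noteq> v"
  shows "{u, v} \<in> edges G" "w {u, v} = -1"
  using assms cliques[of i j] is_block_imp_is_subgraph[OF is_block_B[of i]]
  by (auto simp: negative_clique_def is_subgraph_def)

lemma clique_index_unique:
  "\<lbrakk>i \<in> {1..k}; j \<in> {1..m i}; j' \<in> {1..m i}; v \<in> C i j; v \<in> C i j'\<rbrakk> \<Longrightarrow> j = j'"
  using disjoint_family_onD[OF cliques_disjoint] by blast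

lemma block_index_of_edge:
  assumes "{u, v} \<in> edges G"
  obtains i where "i \<in> {1..k}" "{u, v} \<in> edges (B i)" "u \<in> verts (B i)"
proof -
  obtain H where H: "is_block G H" "{u, v} \<in> edges H"
    using edge_in_block signed_block_graph_imp_simple_graph[OF signed_block] assms by metis
  then have "H \<in> B ` {1..k}"
    using bij_betw_imp_surj_on[OF blocks] by simp
  moreover have "u \<in> verts H"
    using simple_graph_edgeD[OF is_block_imp_simple_graph[OF H(1)] H(2)] by simp
  ultimately show thesis
    using that H(2) by blast
qed

lemma block_index_unique:
  assumes edge: "{u, v} \<in> edges G" "w {u, v} = -1"
    and i: "i \<in> {1..k}" "u \<in> verts (B i)" and i': "i' \<in> {1..k}" "u \<in> verts (B i')"
  shows "i = i'"
proof -
  have "\<not> cut_vertex G u"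
    using cut_vertex_positive[OF _ edge(1)] edge(2) by auto
  then have "B i = B i'"
    using vertex_in_two_blocks_is_cut_vertex signed_block_graph_imp_simple_graph[OF signed_block]
      is_block_B i i' by metis
  then show ?thesis
    using inj_onD[OF bij_betw_imp_inj_on[OF blocks]] i(1) i'(1) by blast
qed

lemma negative_edge_in_clique:
  assumes edge: "{u, v} \<in> edges G" "w {u, v} = -1" and i: "i \<in> {1..k}" "u \<in> verts (B i)"
  obtains j where "j \<in> {1..m i}" "u \<in> C i j" "v \<in> C i j"
proof -
  obtain i' where i': "i' \<in> {1..k}" "{u, v} \<in> edges (B i')" "u \<in> verts (B i')"
    using block_index_of_edge[OF edge(1)] by metis
  then have "{u, v} \<in> edges (B i)"
    using block_index_unique[OF edge i i'(1,3)] by simp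
  then have "\<exists>j\<in>{1..m i}. {u, v} \<subseteq> C i j"
    using other_edges_positive[OF i(1)] edge(2) by (metis one_neq_neg_one)
  then show thesis
    using that by blast
qed

sublocale cluster_signed_block_graph G w
proof
  fix u v x
  assume uv: "{u, v} \<in> edges G" "w {u, v} = -1"
    and vx: "{v, x} \<in> edges G" "w {v, x} = -1" and "u \<noteq> x"
  obtain i where i: "i \<in> {1..k}" "v \<in> verts (B i)"
    using block_index_of_edge[OF vx(1)] by metis
  obtain j where j: "j \<in> {1..m i}" "v \<in> C i j" "x \<in> C i j"
    using negative_edge_in_clique[OF vx i] by metis
  obtain j' where "j' \<in> {1..m i}" "v \<in> C i j'" "u \<in> C i j'"
    using negative_edge_in_clique[of v u, OF _ _ i] uv by (metis insert_commute)
  then have "u \<in> C i j"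
    using clique_index_unique[OF i(1)] j by metis
  then show "{u, x} \<in> edges G \<and> w {u, x} = -1"
    using clique_edge_negative[OF i(1) j(1) _ j(3) \<open>u \<noteq> x\<close>] by simp
qed (use signed_block cut_vertex_positive in auto)

lemma negative_class_clique:
  assumes "i \<in> {1..k}" "j \<in> {1..m i}" "v \<in> C i j"
  shows "\<kappa> v = C i j"
proof (intro equalityI subsetI)
  fix u assume "u \<in> \<kappa> v"
  show "u \<in> C i j"
  proof (cases "u = v")
    case False
    then have "{v, u} \<in> edges G" "w {v, u} = -1"
      using \<open>u \<in> \<kappa> v\<close> by (simp_all add: negative_class_def insert_commute)
    moreover have "v \<in> verts (B i)"
      using clique_subset assms by blast
    ultimately obtain j' where "j' \<in> {1..m i}" "v \<in> C i j'" "u \<in> C i j'"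
      using negative_edge_in_clique assms(1) by metis
    then show ?thesis
      using clique_index_unique assms by metis
  qed (use assms in simp)
next
  fix u assume "u \<in> C i j"
  then show "u \<in> \<kappa> v"
    using clique_edge_negative[OF assms(1,2) _ assms(3)] by (auto simp: negative_class_def)
qed

lemma negative_class_outside_cliques:
  assumes "i \<in> {1..k}" "v \<in> verts (B i)" "v \<notin> (\<Union>j\<in>{1..m i}. C i j)"
  shows "\<kappa> v = {v}"
proof -
  have "\<not> ({u, v} \<in> edges G \<and> w {u, v} = -1)" for u
    using negative_edge_in_clique[of v u i] assms by (metis UN_I insert_commute)
  then show ?thesis
    by (auto simp: negative_class_def)
qed

lemma sum_clique_correction_block:
  assumes i: "i \<in> {1..k}"
  shows "(\<Sum>v\<in>verts (B i). clique_correction (card (\<kappa> v)))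
       = (\<Sum>j=1..m i. real (card (C i j)) * clique_correction (card (C i j)))"
proof -
  have "(\<Union>j\<in>{1..m i}. C i j) \<subseteq> verts (B i)"
    by (intro UN_least clique_subset[OF i])
  then have "(\<Sum>v\<in>verts (B i). clique_correction (card (\<kappa> v)))
      = (\<Sum>v\<in>(\<Union>j\<in>{1..m i}. C i j). clique_correction (card (\<kappa> v)))"
    using negative_class_outside_cliques[OF i] by (intro sum.mono_neutral_right) auto
  also have "\<dots> = (\<Sum>j=1..m i. \<Sum>v\<in>C i j. clique_correction (card (\<kappa> v)))"
    using cliques_disjoint[OF i] by (intro sum.UNION_disjoint) (auto simp: disjoint_family_on_def)
  also have "\<dots> = (\<Sum>j=1..m i. real (card (C i j)) * clique_correction (card (C i j)))"
    by (intro sum.cong refl) (simp add: negative_class_clique[OF i])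
  finally show ?thesis .
qed

lemma inj_on_nontrivial_cliques:
  "inj_on (\<lambda>(i, j). C i j) {(i, j). i \<in> {1..k} \<and> j \<in> {1..m i} \<and> 2 \<le> card (C i j)}"
proof -
  have "i = i' \<and> j = j'"
    if i: "i \<in> {1..k}" "i' \<in> {1..k}" and j: "j \<in> {1..m i}" "j' \<in> {1..m i'}"
      and eq: "C i j = C i' j'" and "2 \<le> card (C i j)" for i j i' j'
  proof -
    obtain u v where uv: "u \<in> C i j" "v \<in> C i j" "u \<noteq> v"
      using \<open>2 \<le> card (C i j)\<close> card_le_Suc0_iff_eq[OF finite, of "C i j"] by force
    moreover have "u \<in> verts (B i)" "u \<in> verts (B i')"
      using clique_subset i j uv eq by blast+
    ultimately have "i = i'"
      using block_index_unique[of u v i i'] clique_edge_negative[of i j u v] i j by simp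
    then show ?thesis
      using clique_index_unique[of i j j' u] i j uv eq by simp
  qed
  then show ?thesis
    by (auto simp: inj_on_def)
qed

lemma range_negative_class_nontrivial:
  "{c \<in> range \<kappa>. 2 \<le> card c}
  = (\<lambda>(i, j). C i j) ` {(i, j). i \<in> {1..k} \<and> j \<in> {1..m i} \<and> 2 \<le> card (C i j)}"
proof (intro equalityI subsetI)
  fix c assume "c \<in> {c \<in> range \<kappa>. 2 \<le> card c}"
  then obtain v where v: "c = \<kappa> v" "2 \<le> card (\<kappa> v)"
    by auto
  then have "\<kappa> v \<noteq> {v}"
    by auto
  then obtain u where "{v, u} \<in> edges G"
    by (auto simp: negative_class_def insert_commute)
  then obtain i where i: "i \<in> {1..k}" "v \<in> verts (B i)"
    using block_index_of_edge by metis
  then obtain j where "j \<in> {1..m i}" "v \<in> C i j"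
    using negative_class_outside_cliques \<open>\<kappa> v \<noteq> {v}\<close> by blast
  then show "c \<in> (\<lambda>(i, j). C i j) ` {(i, j). i \<in> {1..k} \<and> j \<in> {1..m i} \<and> 2 \<le> card (C i j)}"
    using negative_class_clique[OF i(1)] v i(1) by (auto intro!: image_eqI[of _ _ "(i, j)"])
next
  fix c assume "c \<in> (\<lambda>(i, j). C i j) ` {(i, j). i \<in> {1..k} \<and> j \<in> {1..m i} \<and> 2 \<le> card (C i j)}"
  then obtain i j where c: "c = C i j" "2 \<le> card c" and ij: "i \<in> {1..k}" "j \<in> {1..m i}"
    by auto
  then obtain v where "v \<in> c"
    by fastforce
  then have "c = \<kappa> v"
    using negative_class_clique ij c by simp
  then show "c \<in> {c \<in> range \<kappa>. 2 \<le> card c}"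
    using c by simp
qed

lemma prod_negative_classes_eq_prod_cliques:
  fixes g :: "nat \<Rightarrow> 'a::comm_monoid_mult"
  assumes trivial: "g 0 = 1" "g 1 = 1"
  shows "(\<Prod>c\<in>range \<kappa>. g (card c)) = (\<Prod>i=1..k. \<Prod>j=1..m i. g (card (C i j)))"
proof -
  have g_trivial: "g s = 1" if "\<not> 2 \<le> s" for s
    using that trivial by (cases s) (auto simp: not_le less_Suc_eq)
  let ?P = "SIGMA i:{1..k}. {1..m i}"
  let ?N = "{(i, j). i \<in> {1..k} \<and> j \<in> {1..m i} \<and> 2 \<le> card (C i j)}"
  have "(\<Prod>c\<in>range \<kappa>. g (card c)) = (\<Prod>c\<in>{c \<in> range \<kappa>. 2 \<le> card c}. g (card c))"
    using g_trivial by (intro prod.mono_neutral_right) auto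
  also have "\<dots> = (\<Prod>(i, j)\<in>?N. g (card (C i j)))"
    unfolding range_negative_class_nontrivial prod.reindex[OF inj_on_nontrivial_cliques]
    by (simp add: case_prod_unfold)
  also have "\<dots> = (\<Prod>(i, j)\<in>?P. g (card (C i j)))"
    using g_trivial by (intro prod.mono_neutral_left) auto
  also have "\<dots> = (\<Prod>i=1..k. \<Prod>j=1..m i. g (card (C i j)))"
    by (rule prod.Sigma[symmetric]) auto
  finally show ?thesis .
qed

text \<open>The signs \<open>(-1) ^ s\<close> make the factors of trivial classes equal to \<open>1\<close>; over all classes they
  multiply to \<open>(-1) ^ CARD('v)\<close>.\<close>

lemma prod_negative_classes:
  "(\<Prod>c\<in>range \<kappa>. 1 - 2 * real (card c))
  = (-1) ^ CARD('v) * (\<Prod>i=1..k. \<Prod>j=1..m i. (-1) ^ card (C i j) * (1 - 2 * real (card (C i j))))"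
proof -
  have "(\<Prod>c\<in>range \<kappa>. (-1) ^ card c) = (\<Prod>c\<in>range \<kappa>. \<Prod>v | \<kappa> v = c. (-1 :: real))"
  proof (intro prod.cong refl)
    fix c assume "c \<in> range \<kappa>"
    then show "(-1) ^ card c = (\<Prod>v | \<kappa> v = c. (-1 :: real))"
      by (elim rangeE) (simp add: negative_class_fibre)
  qed
  also have "\<dots> = (-1) ^ CARD('v)"
    using prod.image_gen[of UNIV "\<lambda>_. -1 :: real" \<kappa>] by simp
  finally have signs: "(\<Prod>c\<in>range \<kappa>. (-1) ^ card c) = (-1 :: real) ^ CARD('v)" .
  have "(\<Prod>c\<in>range \<kappa>. 1 - 2 * real (card c))
      = (\<Prod>c\<in>range \<kappa>. (-1) ^ card c * ((-1) ^ card c * (1 - 2 * real (card c))))"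
    by simp
  also have "\<dots> = (-1) ^ CARD('v) * (\<Prod>c\<in>range \<kappa>. (-1) ^ card c * (1 - 2 * real (card c)))"
    by (simp only: prod.distrib[of "\<lambda>c. (-1) ^ card c"] signs)
  finally show ?thesis
    using prod_negative_classes_eq_prod_cliques[of "\<lambda>s. (-1) ^ s * (1 - 2 * real s)"] by simp
qed

theorem det_adjacency_matrix_eq_sum_over_cliques:
  "det (adjacency_matrix G w) = (-1) ^ CARD('v) * (\<Sum>\<alpha>\<in>admissible_tuples G k B. \<Prod>i=1..k.
    (\<Prod>j=1..m i. (-1) ^ card (C i j) * (1 - 2 * real (card (C i j))))
    * (1 - real (\<alpha> i) + (\<Sum>j=1..m i. real (card (C i j)) * clique_correction (card (C i j)))))"
proof -
  have "(\<Sum>\<alpha>\<in>admissible_tuples G k B. \<Prod>i=1..k.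
          1 - real (\<alpha> i) + (\<Sum>v\<in>verts (B i). clique_correction (card (\<kappa> v))))
      = (\<Sum>\<alpha>\<in>admissible_tuples G k B. \<Prod>i=1..k.
          1 - real (\<alpha> i) + (\<Sum>j=1..m i. real (card (C i j)) * clique_correction (card (C i j))))"
    by (intro sum.cong prod.cong) (simp_all add: sum_clique_correction_block)
  then show ?thesis
    by (simp only: det_adjacency_matrix_eq_sum_admissible_tuples[OF spanning blocks]
        prod_negative_classes prod.distrib sum_distrib_left mult.assoc)
qed

end

lemma uniform_clique_factor:
  fixes a :: real
  shows "(1 - 2 * real r) powi (int m - 1) * (-1) powi (- int (m * r)) *
      (a * (1 - 2 * real r) + 2 * real r * (1 + real m * (real r - 1)) - 1)
    = - ((\<Prod>j=1..m. (-1) ^ r * (1 - 2 * real r))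
         * (1 - a + (\<Sum>j=1..m. real r * clique_correction r)))"
proof -
  define q where "q = 1 - 2 * real r"
  have q: "q \<noteq> 0" and r: "real r = (1 - q) / 2"
    using one_minus_double_neq_0 by (simp_all add: q_def)
  have "q powi (int m - 1) = q ^ m / q"
    using q by (simp add: power_int_diff)
  moreover have "(-1 :: real) powi (- int (m * r)) = (-1) ^ (m * r)"
    by (simp only: power_int_minus power_int_of_nat flip: power_inverse) simp
  moreover have "a * q + 2 * real r * (1 + real m * (real r - 1)) - 1
      = - (q * (1 - a + real m * (real r * clique_correction r)))"
    using q by (simp add: r clique_correction_def field_simps)
  ultimately show ?thesis
    using q by (simp add: power_mult_distrib power_mult[symmetric] mult.commute[of m r] flip: q_def)
qed

theorem theorem7:
  fixes G :: "('v::finite) graph" and w :: "'v set \<Rightarrow> real"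
    and n k :: nat and B :: "nat \<Rightarrow> 'v graph"
    and m r :: "nat \<Rightarrow> nat" and C :: "nat \<Rightarrow> nat \<Rightarrow> 'v set"
  assumes "signed_block_graph G w"
    and "verts G = UNIV" and "n = card (verts G)"
    and "bij_betw B {1..k} {H. is_block G H}"
    and "\<And>x e. cut_vertex G x \<Longrightarrow> e \<in> edges G \<Longrightarrow> x \<in> e \<Longrightarrow> w e = 1"
    and "\<And>i j. i \<in> {1..k} \<Longrightarrow> j \<in> {1..m i} \<Longrightarrow>
           negative_clique (B i) w (C i j) \<and> card (C i j) = r i"
    and "\<And>i. i \<in> {1..k} \<Longrightarrow> disjoint_family_on (C i) {1..m i}"
    and "\<And>i. i \<in> {1..k} \<Longrightarrow> int (m i * r i) \<le> int (card (verts (B i))) - 1"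
    and "\<And>i e. i \<in> {1..k} \<Longrightarrow> e \<in> edges (B i) \<Longrightarrow>
           \<not> (\<exists>j\<in>{1..m i}. e \<subseteq> C i j) \<Longrightarrow> w e = 1"
  shows "det (adjacency_matrix G w) =
    (-1) powi (int n - int k) *
    (\<Sum>\<alpha>\<in>admissible_tuples G k B.
      \<Prod>i=1..k. (1 - 2 * real (r i)) powi (int (m i) - 1) * (-1) powi (- int (m i * r i)) *
        (real (\<alpha> i) * (1 - 2 * real (r i))
          + 2 * real (r i) * (1 + real (m i) * (real (r i) - 1)) - 1))"
proof -
  interpret block_graph_with_negative_cliques G w k B m C
    using assms(1,2,4-7,9) by unfold_locales auto
  have sign: "(-1 :: real) powi (int n - int k) = (-1) ^ n * (-1) ^ k"
    by (simp add: power_int_diff divide_inverse flip: power_inverse)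
  have "det (adjacency_matrix G w) = (-1) ^ n * (\<Sum>\<alpha>\<in>admissible_tuples G k B. \<Prod>i=1..k.
      (\<Prod>j=1..m i. (-1) ^ r i * (1 - 2 * real (r i)))
      * (1 - real (\<alpha> i) + (\<Sum>j=1..m i. real (r i) * clique_correction (r i))))"
    using assms(2,3,6) det_adjacency_matrix_eq_sum_over_cliques by simp
  then show ?thesis
    unfolding uniform_clique_factor prod_uminus sign by (simp add: sum_distrib_left mult.assoc)
qed

end
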